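(* Let $M$ be a screen generic lightlike submanifold of a locally bronze semi-Riemannian manifold $(\bar M,\bar g,\bar J)$ with an $(l,m)$-type connection $\bar\Omega$. Then the distribution $B'$ is integrable if and only if both of the following hold for any $Y,Z\in\Gamma(B')$ (the paper's quantifier also lists $X\in\Gamma(B_o)$ and $N\in\Gamma(\mathrm{ltr}(TM))$, which do not occur in the conditions): (i) $\Omega^{*}_YfZ+\bar A_{wY}Z+3\Omega^{*}_ZY-\Omega^{*}_ZfY-\bar A_{wZ}Y-3\Omega^{*}_YZ$ has no component in $\Gamma(B_o)$; (ii) $\bar A_{wY}Z+\bar h^{*}(Y,fZ)+3\bar h^{*}(Z,Y)=\bar A_{wZ}Y+\bar h^{*}(Z,fY)+3\bar h^{*}(Y,Z)$.
   Context: Bronze manifold: a semi-Riemannian manifold $(\bar M,\bar g)$ (of constant index $q$, $1\le q\le \dim\bar M-1$) with a $(1,1)$-tensor field $\bar J$ satisfying $\bar J^2=3\bar J+I$ and $\bar g(\bar JX,Y)=\bar g(X,\bar JY)$; it is locally bronze if $\bar\nabla\bar J=0$ for the Levi-Civita connection $\bar\nabla$. Lightlike submanifold: $M\subset\bar M$ such that $\mathrm{Rad}\,TM=TM\cap TM^\perp$ is a distribution of constant rank $r>0$; $g$ is the induced metric. One fixes $S(TM)$, $S(TM^\perp)$ with $TM=\mathrm{Rad}\,TM\perp S(TM)$, $TM^\perp=\mathrm{Rad}\,TM\perp S(TM^\perp)$, and a lightlike transversal bundle $\mathrm{ltr}(TM)$ (locally spanned by $N_1,\dots,N_r$ in $S(TM^\perp)^\perp$,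 orthogonal to $S(TM)$, with $\bar g(N_i,\xi_j)=\delta_{ij}$, $\bar g(N_i,N_j)=0$ for a local basis $\xi_1,\dots,\xi_r$ of $\mathrm{Rad}\,TM$). Then $T\bar M|_M=TM\oplus \mathrm{tr}(TM)$ with $\mathrm{tr}(TM)=\mathrm{ltr}(TM)\perp S(TM^\perp)$. For $X\in\Gamma(TM)$ write $\bar JX=fX+wX$ with $fX$ tangential and $wX\in\Gamma(\mathrm{tr}(TM))$. Screen generic: $M$ is screen generic if $\bar J(\mathrm{Rad}\,TM)=\mathrm{Rad}\,TM$ and $B_o=\bar J(S(TM))\cap S(TM)$ is a non-degenerate distribution; $B'$ denotes the complementary non-degenerate distribution in $S(TM)$, so $S(TM)=B_o\oplus B'$, with $\bar J(B')\not\subseteq S(TM)$ and $\bar J(B')\not\subseteq S(TM^\perp)$, and $fY\in\Gamma(B')$, $wY\in\Gamma(S(TM^\perp))$ for $Y\in\Gamma(B')$. $(l,m)$-type connection: let $l,m$ be smooth functions on $\bar M$, $(l,m)\ne(0,0)$, $\eta$ a smooth unit spacelike vector field on $\bar M$, $\theta(X)=\bar g(X,\eta)$. Then $\bar\Omega_XY=\bar\nabla_XY+\theta(Y)\{lX+m\bar JX\}$. Induced objects: for $X,Y\in\Gamma(TM)$, $\bar\Omega_XY=\Omega_XY+\bar h^{l}(X,Y)+\bar h^{s}(X,Y)$ with components in $TM$, $\mathrm{ltr}(TM)$, $S(TM^\perp)$ respectively; for $W\in\Gamma(S(TM^\perp))$, $\bar\Omega_XW=-\bar A_WX+\bar\Omega^s_XW+\bar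 D^l(X,W)$ with components in $TM$, $S(TM^\perp)$, $\mathrm{ltr}(TM)$ respectively; for $Y\in\Gamma(S(TM))$, $\Omega_XY=\Omega^{*}_XY+\bar h^{*}(X,Y)$ with $\Omega^*_XY\in\Gamma(S(TM))$, $\bar h^*(X,Y)\in\Gamma(\mathrm{Rad}\,TM)$. A distribution is integrable if it is closed under the Lie bracket of its sections. The component in $B_o$ refers to the decomposition of $TM$ into $B_o$, $B'$ and $\mathrm{Rad}\,TM$.
   Formalization: In (ii) the vectors Ā_{wY}Z and Ā_{wZ}Y are replaced by their Rad TM-components along S(TM), so (ii) is an equation in Rad TM; read for full tangent vectors, the "only if" direction is false (flat example with l=1, m=0, θ(wY)≠0). *)

theory Defs
  imports "HOL-Analysis.Analysis"
begin

section \<open>Smooth manifolds and tangent vectors\<close>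

primrec Ck_on :: "nat \<Rightarrow> 'v set \<Rightarrow> ('v::real_normed_vector \<Rightarrow> 'w::real_normed_vector) \<Rightarrow> bool" where
  "Ck_on 0 S f \<longleftrightarrow> continuous_on S f"
| "Ck_on (Suc k) S f \<longleftrightarrow> (\<forall>x\<in>S. f differentiable (at x)) \<and>
     (\<forall>v. Ck_on k S (\<lambda>x. frechet_derivative f (at x) v))"

text \<open>Only used for open sets \<open>S\<close>.\<close>

definition smooth_on :: "'v set \<Rightarrow> ('v::real_normed_vector \<Rightarrow> 'w::real_normed_vector) \<Rightarrow> bool" where
  "smooth_on S f \<longleftrightarrow> (\<forall>k. Ck_on k S f)"

type_synonym ('a, 'e) chart = "'a set \<times> ('a \<Rightarrow> 'e)"

record ('a, 'e) smooth_mfd =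
  topo :: "'a topology"
  atlas :: "('a, 'e) chart set"

abbreviation carrier :: "('a, 'e) smooth_mfd \<Rightarrow> 'a set" where
  "carrier M \<equiv> topspace (topo M)"

definition chart_inv :: "('a, 'e) chart \<Rightarrow> 'e \<Rightarrow> 'a" where
  "chart_inv C = inv_into (fst C) (snd C)"

definition smooth_manifold :: "('a, 'e::euclidean_space) smooth_mfd \<Rightarrow> bool" where
  "smooth_manifold M \<longleftrightarrow>
     Hausdorff_space (topo M) \<and> second_countable (topo M) \<and>
     (\<Union>C\<in>atlas M. fst C) = carrier M \<and>
     (\<forall>C\<in>atlas M. openin (topo M) (fst C) \<and> open (snd C ` fst C) \<and>
        homeomorphic_map (subtopology (topo M) (fst C)) (top_of_set (snd C ` fst C)) (snd C)) \<and>
     (\<forall>C\<in>atlas M. \<forall>C'\<in>atlas M.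
        smooth_on (snd C ` (fst C \<inter> fst C')) (snd C' \<circ> chart_inv C))"

text \<open>
  Every point \<open>p\<close> has a preferred chart \<open>chart_at M p\<close>, and the tangent space at \<open>p\<close> is the model
  space \<open>'e\<close>: a tangent vector is represented by its components in the preferred chart at its own
  base point. Since the preferred chart varies with \<open>p\<close> in an arbitrary way, everything that
  compares tangent vectors at different points (smoothness, derivatives) has to pass
  to the components \<open>to_chart M C p v\<close> in one fixed chart \<open>C\<close>.
\<close>

definition chart_at :: "('a, 'e) smooth_mfd \<Rightarrow> 'a \<Rightarrow> ('a, 'e) chart" where
  "chart_at M p = (SOME C. C \<in> atlas M \<and> p \<in> fst C)"

definition to_chart :: "('a, 'e::euclidean_space) smooth_mfd \<Rightarrow> ('a, 'e) chart \<Rightarrow> 'a \<Rightarrow> 'e \<Rightarrow> 'e" where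
  "to_chart M C p v =
     frechet_derivative (snd C \<circ> chart_inv (chart_at M p)) (at (snd (chart_at M p) p)) v"

definition from_chart :: "('a, 'e::euclidean_space) smooth_mfd \<Rightarrow> ('a, 'e) chart \<Rightarrow> 'a \<Rightarrow> 'e \<Rightarrow> 'e" where
  "from_chart M C p u =
     frechet_derivative (snd (chart_at M p) \<circ> chart_inv C) (at (snd C p)) u"

definition smooth_fun :: "('a, 'e::euclidean_space) smooth_mfd \<Rightarrow> ('a \<Rightarrow> real) \<Rightarrow> bool" where
  "smooth_fun M f \<longleftrightarrow> (\<forall>C\<in>atlas M. smooth_on (snd C ` fst C) (f \<circ> chart_inv C))"


section \<open>Submanifolds, vector fields along them, distributions\<close>

text \<open>The differential at \<open>p\<close> of the inclusion of \<open>N\<close> into \<open>M\<close>.\<close>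

definition dincl :: "('a, 'e::euclidean_space) smooth_mfd \<Rightarrow> ('a, 'f::euclidean_space) smooth_mfd \<Rightarrow>
    'a \<Rightarrow> 'f \<Rightarrow> 'e" where
  "dincl M N p = frechet_derivative (snd (chart_at M p) \<circ> chart_inv (chart_at N p))
     (at (snd (chart_at N p) p))"

text \<open>\<open>N\<close> carries its own topology and smooth structure and the inclusion is an immersion;
  embedded submanifolds are the case where the topology is the induced one.\<close>

definition submanifold :: "('a, 'e::euclidean_space) smooth_mfd \<Rightarrow> ('a, 'f::euclidean_space) smooth_mfd \<Rightarrow> bool" where
  "submanifold M N \<longleftrightarrow> smooth_manifold M \<and> smooth_manifold N \<and>
     carrier N \<subseteq> carrier M \<and> continuous_map (topo N) (topo M) (\<lambda>p. p) \<and>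
     (\<forall>c\<in>atlas N. \<forall>C\<in>atlas M. smooth_on (snd c ` (fst c \<inter> fst C)) (snd C \<circ> chart_inv c)) \<and>
     (\<forall>p\<in>carrier N. inj (dincl M N p))"

definition tangent :: "('a, 'e::euclidean_space) smooth_mfd \<Rightarrow> ('a, 'f::euclidean_space) smooth_mfd \<Rightarrow> 'a \<Rightarrow> 'e set" where
  "tangent M N p = range (dincl M N p)"

definition pull :: "('a, 'e::euclidean_space) smooth_mfd \<Rightarrow> ('a, 'f::euclidean_space) smooth_mfd \<Rightarrow>
    ('a \<Rightarrow> 'e) \<Rightarrow> 'a \<Rightarrow> 'f" where
  "pull M N X p = inv (dincl M N p) (X p)"

text \<open>The section \<open>Y\<close> of \<open>TM\<close> along \<open>N\<close>, written in the chart \<open>C\<close> of \<open>M\<close> as a function of the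
  coordinates of the chart \<open>c\<close> of \<open>N\<close>.\<close>

definition local_rep :: "('a, 'e::euclidean_space) smooth_mfd \<Rightarrow> ('a, 'f) chart \<Rightarrow> ('a, 'e) chart \<Rightarrow>
    ('a \<Rightarrow> 'e) \<Rightarrow> 'f \<Rightarrow> 'e" where
  "local_rep M c C Y x = to_chart M C (chart_inv c x) (Y (chart_inv c x))"

text \<open>\<open>sections M N U E\<close>: smooth sections over the open subset \<open>U\<close> of \<open>N\<close> of a subbundle \<open>E\<close> of the
  restriction of \<open>TM\<close> to \<open>N\<close>. The case \<open>N = M\<close> gives vector fields on \<open>M\<close>.\<close>

definition sections :: "('a, 'e::euclidean_space) smooth_mfd \<Rightarrow> ('a, 'f::euclidean_space) smooth_mfd \<Rightarrow>
    'a set \<Rightarrow> ('a \<Rightarrow> 'e set) \<Rightarrow> ('a \<Rightarrow> 'e) set" where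
  "sections M N U E = {Y. (\<forall>p\<in>U. Y p \<in> E p) \<and>
     (\<forall>c\<in>atlas N. \<forall>C\<in>atlas M. smooth_on (snd c ` (U \<inter> fst c \<inter> fst C)) (local_rep M c C Y))}"

definition distribution :: "('a, 'e::euclidean_space) smooth_mfd \<Rightarrow> ('a, 'f::euclidean_space) smooth_mfd \<Rightarrow>
    nat \<Rightarrow> ('a \<Rightarrow> 'e set) \<Rightarrow> bool" where
  "distribution M N k E \<longleftrightarrow>
     (\<forall>p\<in>carrier N. subspace (E p) \<and> dim (E p) = k) \<and>
     (\<forall>p\<in>carrier N. \<exists>U s. openin (topo N) U \<and> p \<in> U \<and> (\<forall>i<k. s i \<in> sections M N U E) \<and>
        (\<forall>x\<in>U. E x = span ((\<lambda>i. s i x) ` {..<k})))"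

text \<open>Lie bracket of vector fields on \<open>N\<close>: \<open>[Y, Z]^k = Y(Z^k) - Z(Y^k)\<close> in the chart at \<open>p\<close>.\<close>

definition lie_bracket :: "('a, 'f::euclidean_space) smooth_mfd \<Rightarrow> ('a \<Rightarrow> 'f) \<Rightarrow> ('a \<Rightarrow> 'f) \<Rightarrow> 'a \<Rightarrow> 'f" where
  "lie_bracket N Y Z p = (let c = chart_at N p in
     frechet_derivative (local_rep N c c Z) (at (snd c p)) (Y p) -
     frechet_derivative (local_rep N c c Y) (at (snd c p)) (Z p))"

text \<open>The bracket of smooth fields is smooth, so closedness under it only needs to be asked
  pointwise.\<close>

definition integrable_distribution :: "('a, 'e::euclidean_space) smooth_mfd \<Rightarrow>
    ('a, 'f::euclidean_space) smooth_mfd \<Rightarrow> ('a \<Rightarrow> 'e set) \<Rightarrow> bool" where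
  "integrable_distribution M N E \<longleftrightarrow>
     (\<forall>Y\<in>sections M N (carrier N) E. \<forall>Z\<in>sections M N (carrier N) E. \<forall>p\<in>carrier N.
        dincl M N p (lie_bracket N (pull M N Y) (pull M N Z) p) \<in> E p)"


section \<open>Semi-Riemannian metrics and the Levi-Civita connection\<close>

definition nondegenerate_on :: "('e \<Rightarrow> 'e \<Rightarrow> real) \<Rightarrow> ('e::euclidean_space) set \<Rightarrow> bool" where
  "nondegenerate_on b A \<longleftrightarrow> (\<forall>v\<in>A. (\<forall>u\<in>A. b v u = 0) \<longrightarrow> v = 0)"

definition index_of :: "('e::euclidean_space \<Rightarrow> 'e \<Rightarrow> real) \<Rightarrow> nat" where
  "index_of b = Max {dim W |W. subspace W \<and> (\<forall>w\<in>W. w \<noteq> 0 \<longrightarrow> b w w < 0)}"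

text \<open>Components of the metric, and of an endomorphism field, in the chart \<open>C\<close>.\<close>

definition metric_rep :: "('a, 'e::euclidean_space) smooth_mfd \<Rightarrow> ('a, 'e) chart \<Rightarrow>
    ('a \<Rightarrow> 'e \<Rightarrow> 'e \<Rightarrow> real) \<Rightarrow> 'e \<Rightarrow> 'e \<Rightarrow> 'e \<Rightarrow> real" where
  "metric_rep M C g u v x = (let p = chart_inv C x in g p (from_chart M C p u) (from_chart M C p v))"

definition endo_rep :: "('a, 'e::euclidean_space) smooth_mfd \<Rightarrow> ('a, 'e) chart \<Rightarrow>
    ('a \<Rightarrow> 'e \<Rightarrow> 'e) \<Rightarrow> 'e \<Rightarrow> 'e \<Rightarrow> 'e" where
  "endo_rep M C J u x = (let p = chart_inv C x in to_chart M C p (J p (from_chart M C p u)))"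

definition semi_riemannian :: "('a, 'e::euclidean_space) smooth_mfd \<Rightarrow> ('a \<Rightarrow> 'e \<Rightarrow> 'e \<Rightarrow> real) \<Rightarrow> nat \<Rightarrow> bool" where
  "semi_riemannian M g q \<longleftrightarrow> smooth_manifold M \<and>
     (\<forall>p\<in>carrier M. bilinear (g p) \<and> (\<forall>u v. g p u v = g p v u) \<and>
        nondegenerate_on (g p) UNIV \<and> index_of (g p) = q) \<and>
     (\<forall>C\<in>atlas M. \<forall>u v. smooth_on (snd C ` fst C) (metric_rep M C g u v))"

text \<open>
  \<open>christoffel M g p u v\<close> is the vector \<open>\<Gamma>\<^sup>k\<^sub>i\<^sub>j u\<^sup>i v\<^sup>j\<close> formed from the Christoffel symbols of \<open>g\<close> in the
  chart at \<open>p\<close>, i.e. \<open>g(\<Gamma>(u,v),w) = (\<partial>\<^sub>u g(v,w) + \<partial>\<^sub>v g(u,w) - \<partial>\<^sub>w g(u,v)) / 2\<close>.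
\<close>

definition christoffel :: "('a, 'e::euclidean_space) smooth_mfd \<Rightarrow> ('a \<Rightarrow> 'e \<Rightarrow> 'e \<Rightarrow> real) \<Rightarrow>
    'a \<Rightarrow> 'e \<Rightarrow> 'e \<Rightarrow> 'e" where
  "christoffel M g p u v = (let C = chart_at M p;
       dg = (\<lambda>a b c. frechet_derivative (metric_rep M C g b c) (at (snd C p)) a) in
     THE z. \<forall>w. 2 * g p z w = dg u v w + dg v u w - dg w u v)"

text \<open>
  Levi-Civita derivative at \<open>p\<close> of a section \<open>Y\<close> of \<open>TM\<close> along \<open>N\<close> in the direction of a
  vector field \<open>X\<close> tangent to \<open>N\<close>:
  \<open>(\<nabla>\<^sub>X Y)\<^sup>k = X(Y\<^sup>k) + \<Gamma>\<^sup>k\<^sub>i\<^sub>j X\<^sup>i Y\<^sup>j\<close> in the chart of \<open>M\<close> at \<open>p\<close>. The case \<open>N = M\<close> is the Levi-Civita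
  connection of \<open>M\<close> itself, and the general case is its restriction to fields along \<open>N\<close>.
\<close>

definition levi_civita :: "('a, 'e::euclidean_space) smooth_mfd \<Rightarrow> ('a, 'f::euclidean_space) smooth_mfd \<Rightarrow>
    ('a \<Rightarrow> 'e \<Rightarrow> 'e \<Rightarrow> real) \<Rightarrow> ('a \<Rightarrow> 'e) \<Rightarrow> ('a \<Rightarrow> 'e) \<Rightarrow> 'a \<Rightarrow> 'e" where
  "levi_civita M N g X Y p = (let c = chart_at N p in
     frechet_derivative (local_rep M c (chart_at M p) Y) (at (snd c p)) (pull M N X p) +
     christoffel M g p (X p) (Y p))"

text \<open>\<open>(\<nabla>\<^sub>v J) u\<close> at \<open>p\<close>, i.e.
  \<open>\<nabla>\<^sub>i J\<^sup>k\<^sub>j = \<partial>\<^sub>i J\<^sup>k\<^sub>j + \<Gamma>\<^sup>k\<^sub>i\<^sub>a J\<^sup>a\<^sub>j - J\<^sup>k\<^sub>a \<Gamma>\<^sup>a\<^sub>i\<^sub>j\<close> in the chart at \<open>p\<close>.\<close>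

definition nabla_endo :: "('a, 'e::euclidean_space) smooth_mfd \<Rightarrow> ('a \<Rightarrow> 'e \<Rightarrow> 'e \<Rightarrow> real) \<Rightarrow>
    ('a \<Rightarrow> 'e \<Rightarrow> 'e) \<Rightarrow> 'a \<Rightarrow> 'e \<Rightarrow> 'e \<Rightarrow> 'e" where
  "nabla_endo M g J p v u = (let C = chart_at M p in
     frechet_derivative (endo_rep M C J u) (at (snd C p)) v +
     christoffel M g p v (J p u) - J p (christoffel M g p v u))"


section \<open>Bronze manifolds and their lightlike submanifolds\<close>

definition bronze_manifold :: "('a, 'e::euclidean_space) smooth_mfd \<Rightarrow> ('a \<Rightarrow> 'e \<Rightarrow> 'e \<Rightarrow> real) \<Rightarrow> nat \<Rightarrow>
    ('a \<Rightarrow> 'e \<Rightarrow> 'e) \<Rightarrow> bool" where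
  "bronze_manifold M g q J \<longleftrightarrow> semi_riemannian M g q \<and> 1 \<le> q \<and> q + 1 \<le> DIM('e) \<and>
     (\<forall>p\<in>carrier M. linear (J p) \<and> (\<forall>v. J p (J p v) = 3 *\<^sub>R J p v + v) \<and>
        (\<forall>u v. g p (J p u) v = g p u (J p v))) \<and>
     (\<forall>C\<in>atlas M. \<forall>u. smooth_on (snd C ` fst C) (endo_rep M C J u))"

definition locally_bronze :: "('a, 'e::euclidean_space) smooth_mfd \<Rightarrow> ('a \<Rightarrow> 'e \<Rightarrow> 'e \<Rightarrow> real) \<Rightarrow> nat \<Rightarrow>
    ('a \<Rightarrow> 'e \<Rightarrow> 'e) \<Rightarrow> bool" where
  "locally_bronze M g q J \<longleftrightarrow> bronze_manifold M g q J \<and>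
     (\<forall>p\<in>carrier M. \<forall>v u. nabla_endo M g J p v u = 0)"

definition sum_of :: "'e::real_vector set \<Rightarrow> 'e set \<Rightarrow> 'e set" where
  "sum_of A B = {a + b |a b. a \<in> A \<and> b \<in> B}"

definition direct_sum :: "'e::real_vector set \<Rightarrow> 'e set \<Rightarrow> 'e set \<Rightarrow> bool" where
  "direct_sum V A B \<longleftrightarrow> A \<inter> B = {0} \<and> V = sum_of A B"

text \<open>The component in \<open>A\<close> of \<open>v\<close> with respect to a direct sum of \<open>A\<close> and \<open>B\<close> containing \<open>v\<close>.\<close>

definition comp_in :: "'e::real_vector set \<Rightarrow> 'e set \<Rightarrow> 'e \<Rightarrow> 'e" where
  "comp_in A B v = (THE a. a \<in> A \<and> v - a \<in> B)"

text \<open>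
  The data of the theorem: the ambient manifold with metric and bronze structure, the
  submanifold with its chosen bundles \<open>S(TM)\<close>, \<open>S(TM\<^sup>\<bottom>)\<close>, \<open>ltr(TM)\<close> (here \<open>scr\<close>, \<open>scrperp\<close>, \<open>ltr\<close>), and the
  functions \<open>l\<close>, \<open>m\<close> and the vector field \<open>\<eta>\<close> of the \<open>(l,m)\<close>-type connection.
\<close>

record ('a, 'e, 'f) lightlike_data =
  amb :: "('a, 'e) smooth_mfd"
  metric :: "'a \<Rightarrow> 'e \<Rightarrow> 'e \<Rightarrow> real"
  brz :: "'a \<Rightarrow> 'e \<Rightarrow> 'e"
  submfd :: "('a, 'f) smooth_mfd"
  scr :: "'a \<Rightarrow> 'e set"
  scrperp :: "'a \<Rightarrow> 'e set"
  ltr :: "'a \<Rightarrow> 'e set"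
  lfun :: "'a \<Rightarrow> real"
  mfun :: "'a \<Rightarrow> real"
  eta :: "'a \<Rightarrow> 'e"

abbreviation tan_sp :: "('a, 'e::euclidean_space, 'f::euclidean_space) lightlike_data \<Rightarrow> 'a \<Rightarrow> 'e set" where
  "tan_sp D \<equiv> tangent (amb D) (submfd D)"

definition perp_sp :: "('a, 'e::euclidean_space, 'f::euclidean_space) lightlike_data \<Rightarrow> 'a \<Rightarrow> 'e set" where
  "perp_sp D p = {v. \<forall>u\<in>tan_sp D p. metric D p v u = 0}"

definition Rad :: "('a, 'e::euclidean_space, 'f::euclidean_space) lightlike_data \<Rightarrow> 'a \<Rightarrow> 'e set" where
  "Rad D p = tan_sp D p \<inter> perp_sp D p"

definition tr :: "('a, 'e::euclidean_space, 'f::euclidean_space) lightlike_data \<Rightarrow> 'a \<Rightarrow> 'e set" where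
  "tr D p = sum_of (ltr D p) (scrperp D p)"

abbreviation \<Gamma>_on :: "('a, 'e::euclidean_space, 'f::euclidean_space) lightlike_data \<Rightarrow> 'a set \<Rightarrow>
    ('a \<Rightarrow> 'e set) \<Rightarrow> ('a \<Rightarrow> 'e) set" where
  "\<Gamma>_on D \<equiv> sections (amb D) (submfd D)"

abbreviation \<Gamma> :: "('a, 'e::euclidean_space, 'f::euclidean_space) lightlike_data \<Rightarrow>
    ('a \<Rightarrow> 'e set) \<Rightarrow> ('a \<Rightarrow> 'e) set" where
  "\<Gamma> D E \<equiv> sections (amb D) (submfd D) (carrier (submfd D)) E"

definition lightlike_transversal :: "('a, 'e::euclidean_space, 'f::euclidean_space) lightlike_data \<Rightarrow> nat \<Rightarrow> bool" where
  "lightlike_transversal D r \<longleftrightarrow> distribution (amb D) (submfd D) r (ltr D) \<and>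
     (\<forall>p\<in>carrier (submfd D). \<exists>U \<xi> n. openin (topo (submfd D)) U \<and> p \<in> U \<and>
        (\<forall>i<r. \<xi> i \<in> \<Gamma>_on D U (Rad D) \<and> n i \<in> \<Gamma>_on D U (ltr D)) \<and>
        (\<forall>x\<in>U. Rad D x = span ((\<lambda>i. \<xi> i x) ` {..<r}) \<and> ltr D x = span ((\<lambda>i. n i x) ` {..<r}) \<and>
           (\<forall>i<r. (\<forall>s\<in>scrperp D x. metric D x (n i x) s = 0) \<and>
                  (\<forall>s\<in>scr D x. metric D x (n i x) s = 0) \<and>
                  (\<forall>j<r. metric D x (n i x) (\<xi> j x) = (if i = j then 1 else 0) \<and>
                         metric D x (n i x) (n j x) = 0))))"

definition lightlike_submanifold :: "('a, 'e::euclidean_space, 'f::euclidean_space) lightlike_data \<Rightarrow> nat \<Rightarrow> bool" where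
  "lightlike_submanifold D r \<longleftrightarrow> submanifold (amb D) (submfd D) \<and>
     0 < r \<and> distribution (amb D) (submfd D) r (Rad D) \<and>
     (\<exists>k. distribution (amb D) (submfd D) k (scr D)) \<and>
     (\<exists>k. distribution (amb D) (submfd D) k (scrperp D)) \<and>
     (\<forall>p\<in>carrier (submfd D).
        direct_sum (tan_sp D p) (Rad D p) (scr D p) \<and>
        (\<forall>u\<in>Rad D p. \<forall>v\<in>scr D p. metric D p u v = 0) \<and>
        direct_sum (perp_sp D p) (Rad D p) (scrperp D p) \<and>
        (\<forall>u\<in>Rad D p. \<forall>v\<in>scrperp D p. metric D p u v = 0)) \<and>
     lightlike_transversal D r"

text \<open>\<open>JX = fX + wX\<close> for \<open>X\<close> tangent to the submanifold.\<close>

definition fpart :: "('a, 'e::euclidean_space, 'f::euclidean_space) lightlike_data \<Rightarrow> ('a \<Rightarrow> 'e) \<Rightarrow> 'a \<Rightarrow> 'e" where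
  "fpart D X p = comp_in (tan_sp D p) (tr D p) (brz D p (X p))"

definition wpart :: "('a, 'e::euclidean_space, 'f::euclidean_space) lightlike_data \<Rightarrow> ('a \<Rightarrow> 'e) \<Rightarrow> 'a \<Rightarrow> 'e" where
  "wpart D X p = comp_in (tr D p) (tan_sp D p) (brz D p (X p))"

definition B_o :: "('a, 'e::euclidean_space, 'f::euclidean_space) lightlike_data \<Rightarrow> 'a \<Rightarrow> 'e set" where
  "B_o D p = brz D p ` scr D p \<inter> scr D p"

text \<open>
  The last clause is stated for sections over arbitrary open subsets; because sections over the
  whole submanifold can be cut off, this is the same as asking it for global sections.
\<close>

definition screen_generic :: "('a, 'e::euclidean_space, 'f::euclidean_space) lightlike_data \<Rightarrow> nat \<Rightarrow>
    ('a \<Rightarrow> 'e set) \<Rightarrow> bool" where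
  "screen_generic D r B' \<longleftrightarrow> lightlike_submanifold D r \<and>
     (\<forall>p\<in>carrier (submfd D). brz D p ` Rad D p = Rad D p) \<and>
     (\<exists>k. distribution (amb D) (submfd D) k (B_o D)) \<and>
     (\<exists>k. distribution (amb D) (submfd D) k B') \<and>
     (\<forall>p\<in>carrier (submfd D). nondegenerate_on (metric D p) (B_o D p) \<and>
        nondegenerate_on (metric D p) (B' p) \<and> direct_sum (scr D p) (B_o D p) (B' p)) \<and>
     \<not> (\<forall>p\<in>carrier (submfd D). brz D p ` B' p \<subseteq> scr D p) \<and>
     \<not> (\<forall>p\<in>carrier (submfd D). brz D p ` B' p \<subseteq> scrperp D p) \<and>
     (\<forall>U. openin (topo (submfd D)) U \<longrightarrow> (\<forall>Y\<in>\<Gamma>_on D U B'.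
        fpart D Y \<in> \<Gamma>_on D U B' \<and> wpart D Y \<in> \<Gamma>_on D U (scrperp D)))"


section \<open>The connection of type \<open>(l,m)\<close> and the induced objects\<close>

definition lm_type :: "('a, 'e::euclidean_space, 'f::euclidean_space) lightlike_data \<Rightarrow> bool" where
  "lm_type D \<longleftrightarrow> smooth_fun (amb D) (lfun D) \<and> smooth_fun (amb D) (mfun D) \<and>
     (\<exists>p\<in>carrier (amb D). (lfun D p, mfun D p) \<noteq> (0, 0)) \<and>
     eta D \<in> sections (amb D) (amb D) (carrier (amb D)) (\<lambda>_. UNIV) \<and>
     (\<forall>p\<in>carrier (amb D). metric D p (eta D p) (eta D p) = 1)"

text \<open>\<open>\<Omega>_bar D X Y\<close> for \<open>X\<close> tangent to the submanifold and \<open>Y\<close> a section of the ambient tangent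
  bundle along it.\<close>

definition \<Omega>_bar :: "('a, 'e::euclidean_space, 'f::euclidean_space) lightlike_data \<Rightarrow>
    ('a \<Rightarrow> 'e) \<Rightarrow> ('a \<Rightarrow> 'e) \<Rightarrow> 'a \<Rightarrow> 'e" where
  "\<Omega>_bar D X Y p = levi_civita (amb D) (submfd D) (metric D) X Y p +
     metric D p (Y p) (eta D p) *\<^sub>R (lfun D p *\<^sub>R X p + mfun D p *\<^sub>R brz D p (X p))"

definition \<Omega>_ind :: "('a, 'e::euclidean_space, 'f::euclidean_space) lightlike_data \<Rightarrow>
    ('a \<Rightarrow> 'e) \<Rightarrow> ('a \<Rightarrow> 'e) \<Rightarrow> 'a \<Rightarrow> 'e" where
  "\<Omega>_ind D X Y p = comp_in (tan_sp D p) (tr D p) (\<Omega>_bar D X Y p)"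

definition A_bar :: "('a, 'e::euclidean_space, 'f::euclidean_space) lightlike_data \<Rightarrow>
    ('a \<Rightarrow> 'e) \<Rightarrow> ('a \<Rightarrow> 'e) \<Rightarrow> 'a \<Rightarrow> 'e" where
  "A_bar D W X p = - comp_in (tan_sp D p) (tr D p) (\<Omega>_bar D X W p)"

definition \<Omega>_star :: "('a, 'e::euclidean_space, 'f::euclidean_space) lightlike_data \<Rightarrow>
    ('a \<Rightarrow> 'e) \<Rightarrow> ('a \<Rightarrow> 'e) \<Rightarrow> 'a \<Rightarrow> 'e" where
  "\<Omega>_star D X Y p = comp_in (scr D p) (Rad D p) (\<Omega>_ind D X Y p)"

definition h_star :: "('a, 'e::euclidean_space, 'f::euclidean_space) lightlike_data \<Rightarrow>
    ('a \<Rightarrow> 'e) \<Rightarrow> ('a \<Rightarrow> 'e) \<Rightarrow> 'a \<Rightarrow> 'e" where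
  "h_star D X Y p = comp_in (Rad D p) (scr D p) (\<Omega>_ind D X Y p)"

definition B_o_comp :: "('a, 'e::euclidean_space, 'f::euclidean_space) lightlike_data \<Rightarrow>
    ('a \<Rightarrow> 'e set) \<Rightarrow> 'a \<Rightarrow> 'e \<Rightarrow> 'e" where
  "B_o_comp D B' p v = comp_in (B_o D p) (sum_of (B' p) (Rad D p)) v"

text \<open>
  \<open>h_star\<close> takes values in \<open>Rad TM\<close>, whereas \<open>A_bar\<close> is only tangent to the submanifold, so an
  equation between radical sections involving \<open>A_bar\<close> is an equation for its \<open>Rad TM\<close>-component
  (equivalently, for the pairings with sections of \<open>ltr(TM)\<close>). The screen components of
  \<open>A\<^bsub>wY\<^esub> Z\<close> and \<open>A\<^bsub>wZ\<^esub> Y\<close> differ in general, even for parallel \<open>B'\<close> in flat space, because the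
  \<open>(l,m)\<close>-type connection contributes \<open>- \<theta>(wY) (l Z + m fZ)\<close> to the former.
\<close>

definition Rad_comp :: "('a, 'e::euclidean_space, 'f::euclidean_space) lightlike_data \<Rightarrow> 'a \<Rightarrow> 'e \<Rightarrow> 'e" where
  "Rad_comp D p v = comp_in (Rad D p) (scr D p) v"

end

theory Submission
  imports Defs
begin

text \<open>
  Write \<open>V = [Y, Z] = \<nabla>\<^sub>Y Z - \<nabla>\<^sub>Z Y\<close> with the Levi-Civita connection \<open>\<nabla>\<close>. Since \<open>\<nabla>J = 0\<close>, the antisymmetrised
  derivative of \<open>JZ = fZ + wZ\<close> in the direction of \<open>Y\<close> is \<open>JV\<close>, and the terms that the \<open>(l,m)\<close>-type
  connection adds have tangential part in \<open>B'\<close>, because \<open>f\<close> maps \<open>B'\<close> to itself. So the tangential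
  vectors in (i) and (ii), put together, are \<open>(f - 3)V\<close> up to an element of \<open>B'\<close>, and the two
  conditions say that \<open>(f - 3)V\<close> has no component in \<open>B\<^sub>o\<close> and none in \<open>Rad TM\<close>. On these two summands
  \<open>f - 3\<close> is \<open>J - 3 = J\<^sup>-\<^sup>1\<close>, an automorphism of each of them, and it maps \<open>B'\<close> into \<open>B'\<close>; hence
  \<open>(f - 3)V\<close> lies in \<open>B'\<close> if and only if \<open>V\<close> does.
\<close>

section \<open>Differential calculus\<close>

text \<open>Conditions (i) and (ii) see the derivatives of \<open>fZ\<close> and \<open>wZ\<close>
  only separately. They recombine to a derivative of \<open>JZ\<close> because both are smooth
  sections, but only terms differentiated in the same direction pair up: the derivative of
  \<open>fZ\<close> along \<open>Y\<close> belongs with \<open>A_bar D (wpart D Z) Y\<close>, not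
  with the term next to it in (i). The analytic obstacle is that tangent vectors are stored in
  charts chosen arbitrarily point by point, and that the bracket on the immersed manifold is formed
  from pulled-back fields, whose differentiability is not given. It has to be recovered from that of
  their images under the injective differential of the inclusion. Torsion-freeness for fields along
  the submanifold then comes down to symmetry of the second derivatives of the inclusion, and no
  field is ever extended to the ambient manifold. The algebraic obstacle is that tangential parts
  make sense only once the tangent space and \<open>tr\<close> are known to be complementary; this
  is not assumed and follows from a dimension count.\<close>

text \<open>The mean value theorem along \<open>u\<close> turns the second difference into a first
  difference of \<open>f' x u\<close> in the direction \<open>v\<close>, and the linear expansion of
  \<open>f' x u\<close> at \<open>x0\<close> evaluates that one.\<close>

lemma second_difference_estimate:
  fixes f :: "'v::real_normed_vector \<Rightarrow> real"
  assumes S: "open S" "x0 \<in> S"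
    and f': "\<And>x. x \<in> S \<Longrightarrow> (f has_derivative f' x) (at x)"
    and G: "((\<lambda>x. f' x u) has_derivative G) (at x0)"
    and e: "e > 0"
  shows "\<exists>d>0. \<forall>t. 0 < t \<and> t < d \<longrightarrow>
    \<bar>f (x0 + t *\<^sub>R u + t *\<^sub>R v) - f (x0 + t *\<^sub>R u) - f (x0 + t *\<^sub>R v) + f x0 - t\<^sup>2 * G v\<bar> \<le> e * t\<^sup>2"
proof -
  \<comment> \<open>\<open>t * K\<close> bounds every displacement that occurs for step size
    \<open>t\<close>; the summand 1 keeps \<open>K\<close> positive when \<open>u\<close> and
    \<open>v\<close> both vanish.\<close>
  define K where "K = norm u + norm v + 1"
  have K: "K > 0" "norm u + norm v \<le> K"
    unfolding K_def by (simp_all add: add_nonneg_pos)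
  have linG: "linear G" using G has_derivative_linear by blast
  \<comment> \<open>The expansion is used at two points at distance at most \<open>t * K\<close>
    from \<open>x0\<close>; with this factor each costs at most \<open>e * t / 2\<close>.\<close>
  obtain d1 where d1: "d1 > 0" and near: "\<And>y. norm (y - x0) < d1 \<Longrightarrow>
      norm (f' y u - f' x0 u - G (y - x0)) \<le> (e / (2 * K)) * norm (y - x0)"
    using G[unfolded has_derivative_at_alt] e K(1)
    by (metis divide_pos_pos mult_pos_pos zero_less_numeral)
  obtain d2 where d2: "d2 > 0" and ball: "\<And>y. norm (y - x0) < d2 \<Longrightarrow> y \<in> S"
    using S open_contains_ball by (metis dist_commute dist_norm mem_ball subsetD)
  define d where "d = min d1 d2 / K"
  have dpos: "d > 0" using d1 d2 K by (simp add: d_def)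
  have "\<bar>f (x0 + t *\<^sub>R u + t *\<^sub>R v) - f (x0 + t *\<^sub>R u) - f (x0 + t *\<^sub>R v) + f x0 - t\<^sup>2 * G v\<bar> \<le> e * t\<^sup>2"
    if t: "0 < t" "t < d" for t
  proof -
    have tK: "t * K < d1" "t * K < d2"
      using t K by (auto simp: d_def field_simps)
    have small: "norm (a *\<^sub>R u + b *\<^sub>R v) \<le> t * K" if "0 \<le> a" "a \<le> t" "0 \<le> b" "b \<le> t" for a b
    proof -
      have "norm (a *\<^sub>R u + b *\<^sub>R v) \<le> a * norm u + b * norm v"
        using norm_triangle_ineq[of "a *\<^sub>R u" "b *\<^sub>R v"] that by simp
      also have "\<dots> \<le> t * norm u + t * norm v"
        using that by (intro add_mono mult_right_mono) auto
      also have "\<dots> = t * (norm u + norm v)" by (simp add: algebra_simps)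
      also have "\<dots> \<le> t * K" using t K by (intro mult_left_mono) auto
      finally show ?thesis .
    qed
    define h where "h s = f (x0 + s *\<^sub>R u + t *\<^sub>R v) - f (x0 + s *\<^sub>R u)" for s
    have der: "DERIV h s :> f' (x0 + s *\<^sub>R u + t *\<^sub>R v) u - f' (x0 + s *\<^sub>R u) u"
      if s: "0 \<le> s" "s \<le> t" for s
    proof -
      have S1: "x0 + s *\<^sub>R u + t *\<^sub>R v \<in> S"
        using small[of s t] s t tK by (intro ball) (simp add: add.assoc)
      have S2: "x0 + s *\<^sub>R u \<in> S"
        using small[of s 0] s t tK by (intro ball) simp
      have 1: "((\<lambda>s. x0 + s *\<^sub>R u + t *\<^sub>R v) has_derivative (\<lambda>r. r *\<^sub>R u)) (at s)"
        by (auto intro!: derivative_eq_intros)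
      have 2: "((\<lambda>s. x0 + s *\<^sub>R u) has_derivative (\<lambda>r. r *\<^sub>R u)) (at s)"
        by (auto intro!: derivative_eq_intros)
      have "(h has_derivative (\<lambda>r. f' (x0 + s *\<^sub>R u + t *\<^sub>R v) (r *\<^sub>R u) - f' (x0 + s *\<^sub>R u) (r *\<^sub>R u))) (at s)"
        unfolding h_def
        by (rule has_derivative_diff[OF has_derivative_compose[OF 1 f'[OF S1]] has_derivative_compose[OF 2 f'[OF S2]]])
      moreover have "(\<lambda>r. f' (x0 + s *\<^sub>R u + t *\<^sub>R v) (r *\<^sub>R u) - f' (x0 + s *\<^sub>R u) (r *\<^sub>R u)) =
          (*) (f' (x0 + s *\<^sub>R u + t *\<^sub>R v) u - f' (x0 + s *\<^sub>R u) u)"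
        using has_derivative_linear[OF f'[OF S1]] has_derivative_linear[OF f'[OF S2]]
        by (auto simp: linear_scale algebra_simps)
      ultimately show ?thesis by (simp add: has_field_derivative_def)
    qed
    have "\<exists>s. 0 < s \<and> s < t \<and>
        h t - h 0 = (t - 0) * (f' (x0 + s *\<^sub>R u + t *\<^sub>R v) u - f' (x0 + s *\<^sub>R u) u)"
      by (rule MVT2[OF t(1)]) (rule der)
    then obtain s where s: "0 < s" "s < t"
      and mv: "h t - h 0 = (t - 0) * (f' (x0 + s *\<^sub>R u + t *\<^sub>R v) u - f' (x0 + s *\<^sub>R u) u)"
      by blast
    have e': "(e / (2 * K)) * norm (a *\<^sub>R u + b *\<^sub>R v) \<le> e * t / 2"
      if "0 \<le> a" "a \<le> t" "0 \<le> b" "b \<le> t" for a b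
    proof -
      have "(e / (2 * K)) * norm (a *\<^sub>R u + b *\<^sub>R v) \<le> (e / (2 * K)) * (t * K)"
        using small[OF that] e K by (intro mult_left_mono) auto
      then show ?thesis using K by simp
    qed
    have b1: "\<bar>f' (x0 + s *\<^sub>R u + t *\<^sub>R v) u - f' x0 u - G (s *\<^sub>R u + t *\<^sub>R v)\<bar> \<le> e * t / 2"
    proof -
      have "norm (s *\<^sub>R u + t *\<^sub>R v) < d1" using small[of s t] s t tK by simp
      then have "\<bar>f' (x0 + s *\<^sub>R u + t *\<^sub>R v) u - f' x0 u - G (s *\<^sub>R u + t *\<^sub>R v)\<bar>
          \<le> (e / (2 * K)) * norm (s *\<^sub>R u + t *\<^sub>R v)"
        using near[of "x0 + s *\<^sub>R u + t *\<^sub>R v"] by (simp add: add.assoc)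
      then show ?thesis using e'[of s t] s by linarith
    qed
    have b2: "\<bar>f' (x0 + s *\<^sub>R u) u - f' x0 u - G (s *\<^sub>R u)\<bar> \<le> e * t / 2"
    proof -
      have "norm (s *\<^sub>R u) < d1" using small[of s 0] s t tK by simp
      then have "\<bar>f' (x0 + s *\<^sub>R u) u - f' x0 u - G (s *\<^sub>R u)\<bar> \<le> (e / (2 * K)) * norm (s *\<^sub>R u)"
        using near[of "x0 + s *\<^sub>R u"] by simp
      then show ?thesis
        using e'[OF less_imp_le[OF s(1)] less_imp_le[OF s(2)] order.refl less_imp_le[OF t(1)]]
        unfolding scaleR_zero_left add_0_right by linarith
    qed
    have Gs: "G (s *\<^sub>R u + t *\<^sub>R v) = G (s *\<^sub>R u) + t * G v"
      using linG by (simp add: linear_add linear_scale)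
    have "\<bar>f' (x0 + s *\<^sub>R u + t *\<^sub>R v) u - f' (x0 + s *\<^sub>R u) u - t * G v\<bar> \<le> e * t"
      using b1 b2 Gs by linarith
    then have "t * \<bar>f' (x0 + s *\<^sub>R u + t *\<^sub>R v) u - f' (x0 + s *\<^sub>R u) u - t * G v\<bar> \<le> t * (e * t)"
      using t by (intro mult_left_mono) auto
    moreover have "t * \<bar>f' (x0 + s *\<^sub>R u + t *\<^sub>R v) u - f' (x0 + s *\<^sub>R u) u - t * G v\<bar> = \<bar>h t - h 0 - t\<^sup>2 * G v\<bar>"
    proof -
      have "h t - h 0 - t\<^sup>2 * G v = t * (f' (x0 + s *\<^sub>R u + t *\<^sub>R v) u - f' (x0 + s *\<^sub>R u) u - t * G v)"
        unfolding mv by (simp add: power2_eq_square right_diff_distrib)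
      then show ?thesis using t by (simp add: abs_mult)
    qed
    moreover have "h t - h 0 = f (x0 + t *\<^sub>R u + t *\<^sub>R v) - f (x0 + t *\<^sub>R u) - f (x0 + t *\<^sub>R v) + f x0"
      by (simp add: h_def)
    ultimately show ?thesis by (simp add: power2_eq_square algebra_simps)
  qed
  then show ?thesis using dpos by blast
qed

text \<open>The second difference is unchanged when \<open>u\<close> and \<open>v\<close> are
  exchanged, so it is asymptotic to both \<open>t^2 * G v\<close> and
  \<open>t^2 * H u\<close>.\<close>

lemma symmetric_second_derivative_real:
  fixes f :: "'v::real_normed_vector \<Rightarrow> real"
  assumes S: "open S" "x0 \<in> S"
    and f': "\<And>x. x \<in> S \<Longrightarrow> (f has_derivative f' x) (at x)"
    and G: "((\<lambda>x. f' x u) has_derivative G) (at x0)"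
    and H: "((\<lambda>x. f' x v) has_derivative H) (at x0)"
  shows "G v = H u"
proof (rule ccontr)
  assume "G v \<noteq> H u"
  \<comment> \<open>A third of the gap, so that two errors of size \<open>e * t^2\<close> cannot
    bridge it.\<close>
  define e where "e = \<bar>G v - H u\<bar> / 3"
  have e: "e > 0" using \<open>G v \<noteq> H u\<close> by (simp add: e_def)
  obtain d1 where d1: "d1 > 0" "\<And>t. 0 < t \<and> t < d1 \<Longrightarrow>
    \<bar>f (x0 + t *\<^sub>R u + t *\<^sub>R v) - f (x0 + t *\<^sub>R u) - f (x0 + t *\<^sub>R v) + f x0 - t\<^sup>2 * G v\<bar> \<le> e * t\<^sup>2"
    using second_difference_estimate[OF S f' G e] by metis
  obtain d2 where d2: "d2 > 0" "\<And>t. 0 < t \<and> t < d2 \<Longrightarrow>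
    \<bar>f (x0 + t *\<^sub>R v + t *\<^sub>R u) - f (x0 + t *\<^sub>R v) - f (x0 + t *\<^sub>R u) + f x0 - t\<^sup>2 * H u\<bar> \<le> e * t\<^sup>2"
    using second_difference_estimate[OF S f' H e] by metis
  define t where "t = min d1 d2 / 2"
  have t: "0 < t" "t < d1" "t < d2" using d1(1) d2(1) by (auto simp: t_def)
  have comm: "x0 + t *\<^sub>R v + t *\<^sub>R u = x0 + t *\<^sub>R u + t *\<^sub>R v" by simp
  have "\<bar>t\<^sup>2 * G v - t\<^sup>2 * H u\<bar> \<le> 2 * (e * t\<^sup>2)"
    using d1(2)[of t] d2(2)[of t] t unfolding comm by linarith
  moreover have "\<bar>t\<^sup>2 * G v - t\<^sup>2 * H u\<bar> = t\<^sup>2 * \<bar>G v - H u\<bar>"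
    by (simp add: abs_mult flip: right_diff_distrib)
  ultimately have "t\<^sup>2 * \<bar>G v - H u\<bar> \<le> 2 * (e * t\<^sup>2)" by simp
  also have "\<dots> = t\<^sup>2 * (2 * e)" by simp
  finally have "t\<^sup>2 * \<bar>G v - H u\<bar> \<le> t\<^sup>2 * (2 * e)" .
  then show False using t e by (simp add: e_def)
qed

lemma symmetric_second_derivative:
  fixes f :: "'v::real_normed_vector \<Rightarrow> 'w::euclidean_space"
  assumes S: "open S" "x0 \<in> S"
    and f': "\<And>x. x \<in> S \<Longrightarrow> (f has_derivative f' x) (at x)"
    and G: "((\<lambda>x. f' x u) has_derivative G) (at x0)"
    and H: "((\<lambda>x. f' x v) has_derivative H) (at x0)"
  shows "G v = H u"
proof (rule euclidean_eqI)
  fix b :: 'w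
  show "G v \<bullet> b = H u \<bullet> b"
    by (rule symmetric_second_derivative_real[OF S, of "\<lambda>x. f x \<bullet> b" "\<lambda>x h. f' x h \<bullet> b"])
      (auto intro!: derivative_intros f' G H)
qed

section \<open>Differentiation through a family of linear maps\<close>

lemma linear_eq_sum_Basis:
  fixes L :: "'v::euclidean_space \<Rightarrow> 'w::real_vector"
  assumes "linear L"
  shows "L v = (\<Sum>b\<in>Basis. (v \<bullet> b) *\<^sub>R L b)"
  using linear_sum[OF assms, of "\<lambda>b. (v \<bullet> b) *\<^sub>R b" Basis]
  by (simp add: euclidean_representation linear_scale[OF assms])

text \<open>A product rule in which the family \<open>E\<close> is differentiated one fixed vector
  at a time; expanding \<open>z x\<close> in the basis reduces it to finitely many scalar
  products.\<close>

lemma has_derivative_apply: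
  fixes E :: "'x::real_normed_vector \<Rightarrow> 'v::euclidean_space \<Rightarrow> 'w::real_normed_vector"
  assumes S: "open S" "x0 \<in> S"
    and lin: "\<And>x. x \<in> S \<Longrightarrow> linear (E x)"
    and E': "\<And>v. ((\<lambda>x. E x v) has_derivative E' v) (at x0)"
    and z: "(z has_derivative z') (at x0)"
  shows "((\<lambda>x. E x (z x)) has_derivative (\<lambda>h. E' (z x0) h + E x0 (z' h))) (at x0)"
proof -
  have "((\<lambda>x. \<Sum>b\<in>Basis. (z x \<bullet> b) *\<^sub>R E x b) has_derivative
      (\<lambda>h. \<Sum>b\<in>Basis. (z x0 \<bullet> b) *\<^sub>R E' b h + (z' h \<bullet> b) *\<^sub>R E x0 b)) (at x0)"
    by (auto intro!: derivative_eq_intros E' z)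
  then have 1: "((\<lambda>x. E x (z x)) has_derivative
      (\<lambda>h. \<Sum>b\<in>Basis. (z x0 \<bullet> b) *\<^sub>R E' b h + (z' h \<bullet> b) *\<^sub>R E x0 b)) (at x0)"
    by (rule has_derivative_transform_within_open[OF _ S]) (metis linear_eq_sum_Basis lin)
  \<comment> \<open>Linearity of \<open>E' v\<close> in \<open>v\<close> is not a premise. It comes
    from differentiating the basis expansion with frozen coefficients and from uniqueness of
    derivatives.\<close>
  have "((\<lambda>x. \<Sum>b\<in>Basis. (z x0 \<bullet> b) *\<^sub>R E x b) has_derivative
      (\<lambda>h. \<Sum>b\<in>Basis. (z x0 \<bullet> b) *\<^sub>R E' b h)) (at x0)"
    by (auto intro!: derivative_eq_intros E')
  then have "((\<lambda>x. E x (z x0)) has_derivative (\<lambda>h. \<Sum>b\<in>Basis. (z x0 \<bullet> b) *\<^sub>R E' b h)) (at x0)"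
    by (rule has_derivative_transform_within_open[OF _ S]) (metis linear_eq_sum_Basis lin)
  then have "E' (z x0) = (\<lambda>h. \<Sum>b\<in>Basis. (z x0 \<bullet> b) *\<^sub>R E' b h)"
    using E' has_derivative_unique by blast
  moreover have "E x0 (z' h) = (\<Sum>b\<in>Basis. (z' h \<bullet> b) *\<^sub>R E x0 b)" for h
    by (rule linear_eq_sum_Basis[OF lin[OF S(2)]])
  ultimately have "(\<lambda>h. \<Sum>b\<in>Basis. (z x0 \<bullet> b) *\<^sub>R E' b h + (z' h \<bullet> b) *\<^sub>R E x0 b) =
      (\<lambda>h. E' (z x0) h + E x0 (z' h))"
    by (metis (no_types, lifting) ext sum.distrib)
  then show ?thesis using 1 by argo
qed

text \<open>Where the vector factor vanishes, the term containing the derivative of the coefficient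
  drops out, so a merely continuous coefficient suffices. This upgrades a continuous solution of a
  linear system to a differentiable one.\<close>

lemma has_derivative_scaleR_zero:
  fixes c :: "'x::real_normed_vector \<Rightarrow> real" and a :: "'x \<Rightarrow> 'w::real_normed_vector"
  assumes c: "continuous (at x0) c" and a: "(a has_derivative a') (at x0)" and a0: "a x0 = 0"
  shows "((\<lambda>x. c x *\<^sub>R a x) has_derivative (\<lambda>h. c x0 *\<^sub>R a' h)) (at x0)"
proof -
  interpret a': bounded_linear a' using a has_derivative_bounded_linear by blast
  obtain K where K: "\<And>h. norm (a' h) \<le> norm h * K" using a'.bounded by blast
  have c0: "((\<lambda>x. c x - c x0) \<longlongrightarrow> 0) (at x0)"
    using c by (simp add: continuous_at LIM_zero_iff)
  have "((\<lambda>x. (1 / norm (x - x0)) *\<^sub>R (a x - (a x0 + a' (x - x0)))) \<longlongrightarrow> 0) (at x0)"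
    using a by (simp add: has_derivative_within)
  then have 1: "((\<lambda>x. c x *\<^sub>R ((1 / norm (x - x0)) *\<^sub>R (a x - (a x0 + a' (x - x0))))) \<longlongrightarrow> c x0 *\<^sub>R 0) (at x0)"
    using c by (intro tendsto_scaleR) (simp add: continuous_at)
  have 2: "((\<lambda>x. (c x - c x0) *\<^sub>R ((1 / norm (x - x0)) *\<^sub>R a' (x - x0))) \<longlongrightarrow> 0) (at x0)"
  proof (rule Lim_null_comparison)
    show "\<forall>\<^sub>F x in at x0. norm ((c x - c x0) *\<^sub>R ((1 / norm (x - x0)) *\<^sub>R a' (x - x0))) \<le> \<bar>c x - c x0\<bar> * K"
      unfolding eventually_at
    proof (intro exI[of _ 1] conjI ballI impI)
      fix x assume "x \<noteq> x0 \<and> dist x x0 < 1"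
      then have "norm ((1 / norm (x - x0)) *\<^sub>R a' (x - x0)) \<le> K"
        using K[of "x - x0"] by (simp add: field_simps)
      then show "norm ((c x - c x0) *\<^sub>R ((1 / norm (x - x0)) *\<^sub>R a' (x - x0))) \<le> \<bar>c x - c x0\<bar> * K"
        by (metis abs_ge_zero mult_left_mono norm_scaleR)
    qed simp
    show "((\<lambda>x. \<bar>c x - c x0\<bar> * K) \<longlongrightarrow> 0) (at x0)"
      using tendsto_mult[OF tendsto_rabs[OF c0] tendsto_const[of K]] by simp
  qed
  \<comment> \<open>The error is \<open>c x\<close> times the remainder of \<open>a\<close>, plus
    the increment of \<open>c\<close> times the bounded quotient of \<open>a'\<close>; both tend to
    zero.\<close>
  have "(1 / norm (x - x0)) *\<^sub>R (c x *\<^sub>R a x - (c x0 *\<^sub>R a x0 + c x0 *\<^sub>R a' (x - x0))) =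
      c x *\<^sub>R ((1 / norm (x - x0)) *\<^sub>R (a x - (a x0 + a' (x - x0)))) +
      (c x - c x0) *\<^sub>R ((1 / norm (x - x0)) *\<^sub>R a' (x - x0))" for x
  proof -
    have "c x *\<^sub>R a x - (c x0 *\<^sub>R a x0 + c x0 *\<^sub>R a' (x - x0)) =
      c x *\<^sub>R (a x - (a x0 + a' (x - x0))) + (c x - c x0) *\<^sub>R a' (x - x0)"
      using a0 by (simp add: scaleR_diff_right scaleR_diff_left)
    then show ?thesis by (simp add: scaleR_add_right mult.commute)
  qed
  then have "((\<lambda>x. (1 / norm (x - x0)) *\<^sub>R (c x *\<^sub>R a x - (c x0 *\<^sub>R a x0 + c x0 *\<^sub>R a' (x - x0)))) \<longlongrightarrow> 0) (at x0)"
    using tendsto_add[OF 1 2] by simp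
  then show ?thesis
    unfolding has_derivative_within
    by (simp add: bounded_linear_scaleR_right[THEN bounded_linear_compose] a'.bounded_linear_axioms
        bounded_linear_const_scaleR)
qed

text \<open>Applying a left inverse \<open>L\<close> of \<open>E x0\<close> turns the equation \<open>E x (z x) = y x\<close> into
  \<open>z x = L (y x) - (L \<circ> E x - id) (z x)\<close>, whose last term is of first order at \<open>x0\<close>.\<close>

lemma differentiable_cancel_linear:
  fixes E :: "'x::real_normed_vector \<Rightarrow> 'v::euclidean_space \<Rightarrow> 'w::euclidean_space"
  assumes S: "open S" "x0 \<in> S"
    and lin: "\<And>x. x \<in> S \<Longrightarrow> linear (E x)"
    and E: "\<And>v. (\<lambda>x. E x v) differentiable (at x0)"
    and inj: "inj (E x0)"
    and y: "(\<lambda>x. E x (z x)) differentiable (at x0)"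
  shows "z differentiable (at x0)"
proof -
  obtain L where L: "linear L" "L \<circ> E x0 = id"
    using linear_injective_left_inverse[OF lin[OF S(2)] inj] by blast
  have bL: "bounded_linear L" using L(1) by (rule linear_conv_bounded_linear[THEN iffD1])
  define a where "a b x = L (E x b) - b" for b x
  define y1 where "y1 x = L (E x (z x))" for x
  have L_diff: "(\<lambda>x. L (h x)) differentiable (at x0)" if "h differentiable (at x0)" for h :: "'x \<Rightarrow> 'w"
    using that bounded_linear.has_derivative[OF bL] unfolding differentiable_def by blast
  have a_diff: "a b differentiable (at x0)" for b
    unfolding a_def by (intro differentiable_diff L_diff E differentiable_const)
  have a0: "a b x0 = 0" for b
    using L(2) by (simp add: a_def fun_eq_iff)
  have y_diff: "y1 differentiable (at x0)"
    unfolding y1_def by (intro L_diff y)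
  have z_eq: "z x = y1 x - (\<Sum>b\<in>Basis. (z x \<bullet> b) *\<^sub>R a b x)" if "x \<in> S" for x
  proof -
    have "(\<Sum>b\<in>Basis. (z x \<bullet> b) *\<^sub>R a b x) = (\<Sum>b\<in>Basis. (z x \<bullet> b) *\<^sub>R L (E x b)) - (\<Sum>b\<in>Basis. (z x \<bullet> b) *\<^sub>R b)"
      by (simp add: a_def scaleR_diff_right sum_subtractf)
    also have "(\<Sum>b\<in>Basis. (z x \<bullet> b) *\<^sub>R L (E x b)) = y1 x"
      unfolding y1_def
      using linear_eq_sum_Basis[OF linear_compose[OF lin[OF that] L(1)], of "z x"] by simp
    finally show ?thesis by (simp add: euclidean_representation)
  qed
  have a_lim: "(a b \<longlongrightarrow> 0) (at x0)" for b
    using differentiable_imp_continuous_within[OF a_diff, of b] by (simp add: continuous_at a0)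
  have y_cont: "(y1 \<longlongrightarrow> y1 x0) (at x0)"
    using differentiable_imp_continuous_within[OF y_diff] by (simp add: continuous_at)
  have z0: "z x0 = y1 x0" using z_eq[OF S(2)] by (simp add: a0)
  define A where "A x = (\<Sum>b\<in>Basis. norm (a b x))" for x
  have A_lim: "(A \<longlongrightarrow> 0) (at x0)"
    unfolding A_def using tendsto_sum[of Basis "\<lambda>b x. norm (a b x)" "\<lambda>_. 0"] a_lim
    by (simp add: tendsto_norm_zero)
  have est: "norm (z x - y1 x) \<le> norm (z x) * A x" if "x \<in> S" for x
  proof -
    have "norm (z x - y1 x) = norm (\<Sum>b\<in>Basis. (z x \<bullet> b) *\<^sub>R a b x)"
      using z_eq[OF that] by (metis add_diff_cancel_left' diff_add_cancel norm_minus_commute)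
    also have "\<dots> \<le> (\<Sum>b\<in>Basis. norm (z x) * norm (a b x))"
      by (rule sum_norm_le) (auto intro!: mult_right_mono Basis_le_norm)
    finally show ?thesis by (simp add: A_def sum_distrib_left)
  qed
  have evS: "\<forall>\<^sub>F x in at x0. x \<in> S"
    using S by (simp add: eventually_at_in_open')
  \<comment> \<open>With \<open>A x\<close> below 1/2 the bound on \<open>z x - y1 x\<close> can be
    absorbed, giving \<open>norm (z x) \<le> 2 * norm (y1 x)\<close>. So \<open>z\<close> is bounded
    near \<open>x0\<close>, hence continuous there, which is what the product with the vanishing
    factors \<open>a b\<close> requires.\<close>
  have evA: "\<forall>\<^sub>F x in at x0. A x < 1/2"
    using order_tendstoD(2)[OF A_lim, of "1/2"] by simp
  have lim: "((\<lambda>x. z x - y1 x) \<longlongrightarrow> 0) (at x0)"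
  proof (rule Lim_null_comparison)
    show "\<forall>\<^sub>F x in at x0. norm (z x - y1 x) \<le> 2 * norm (y1 x) * A x"
      using evS evA
    proof eventually_elim
      case (elim x)
      have "A x \<ge> 0" by (simp add: A_def sum_nonneg)
      have "norm (z x) * A x \<le> norm (z x) * (1/2)"
        using elim by (intro mult_left_mono) auto
      then have "norm (z x) \<le> 2 * norm (y1 x)"
        using est[OF elim(1)] norm_triangle_sub[of "z x" "y1 x"] by simp
      then have "norm (z x) * A x \<le> 2 * norm (y1 x) * A x"
        using \<open>A x \<ge> 0\<close> by (intro mult_right_mono) auto
      then show ?case using est[OF elim(1)] by linarith
    qed
    show "((\<lambda>x. 2 * norm (y1 x) * A x) \<longlongrightarrow> 0) (at x0)"
      using tendsto_mult[OF tendsto_mult[OF tendsto_const[of 2] tendsto_norm[OF y_cont]] A_lim] by simp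
  qed
  have cont: "continuous (at x0) (\<lambda>x. z x \<bullet> b)" for b
    using tendsto_inner[OF tendsto_add[OF lim y_cont] tendsto_const[of b]]
    by (simp add: continuous_at z0)
  have "(\<lambda>x. (z x \<bullet> b) *\<^sub>R a b x) differentiable (at x0)" for b
    using has_derivative_scaleR_zero[where c = "\<lambda>x. z x \<bullet> b" and a = "a b", OF cont _ a0] a_diff[of b] unfolding differentiable_def by blast
  then have "(\<lambda>x. y1 x - (\<Sum>b\<in>Basis. (z x \<bullet> b) *\<^sub>R a b x)) differentiable (at x0)"
    by (intro differentiable_diff y_diff differentiable_sum) auto
  then obtain D where "((\<lambda>x. y1 x - (\<Sum>b\<in>Basis. (z x \<bullet> b) *\<^sub>R a b x)) has_derivative D) (at x0)"
    unfolding differentiable_def by blast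
  then have "(z has_derivative D) (at x0)"
    by (rule has_derivative_transform_within_open[OF _ S]) (rule z_eq[symmetric])
  then show ?thesis unfolding differentiable_def by blast
qed

section \<open>Charts and the Lie bracket\<close>

lemma smooth_on_differentiable:
  assumes "smooth_on S f" "x \<in> S"
  shows "f differentiable (at x)"
  using assms Ck_on.simps(2)[of 0 S f] unfolding smooth_on_def by metis

lemma smooth_on_frechet_derivative:
  assumes "smooth_on S f"
  shows "smooth_on S (\<lambda>x. frechet_derivative f (at x) v)"
  using assms unfolding smooth_on_def by (metis Ck_on.simps(2))

lemma chart_at_mem:
  assumes "smooth_manifold M" "p \<in> carrier M"
  shows "chart_at M p \<in> atlas M" "p \<in> fst (chart_at M p)"
proof -
  have "\<exists>C. C \<in> atlas M \<and> p \<in> fst C"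
    using assms unfolding smooth_manifold_def by blast
  from someI_ex[OF this] show "chart_at M p \<in> atlas M" "p \<in> fst (chart_at M p)"
    unfolding chart_at_def by auto
qed

lemma chart_domain:
  assumes "smooth_manifold M" "C \<in> atlas M"
  shows "openin (topo M) (fst C)" "fst C \<subseteq> carrier M"
  using assms openin_subset[of "topo M" "fst C"] unfolding smooth_manifold_def by auto

lemma chart_inj_on:
  assumes "smooth_manifold M" "C \<in> atlas M"
  shows "inj_on (snd C) (fst C)"
proof -
  have "homeomorphic_map (subtopology (topo M) (fst C)) (top_of_set (snd C ` fst C)) (snd C)"
    using assms unfolding smooth_manifold_def by blast
  then have "inj_on (snd C) (topspace (subtopology (topo M) (fst C)))"
    by (rule homeomorphic_imp_injective_map)
  then show ?thesis using chart_domain(2)[OF assms] by (simp add: Int_absorb1)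
qed

lemma chart_inv_chart:
  assumes "smooth_manifold M" "C \<in> atlas M" "p \<in> fst C"
  shows "chart_inv C (snd C p) = p"
  unfolding chart_inv_def using chart_inj_on[OF assms(1,2)] assms(3) by (rule inv_into_f_f)

lemma open_chart_image:
  assumes "smooth_manifold M" "C \<in> atlas M" "openin (topo M) U"
  shows "open (snd C ` (U \<inter> fst C))"
proof -
  have hom: "homeomorphic_map (subtopology (topo M) (fst C)) (top_of_set (snd C ` fst C)) (snd C)"
    and op: "open (snd C ` fst C)"
    using assms unfolding smooth_manifold_def by blast+
  have "openin (subtopology (topo M) (fst C)) (U \<inter> fst C)"
    using assms(3) by (auto simp: openin_subtopology)
  then have "openin (top_of_set (snd C ` fst C)) (snd C ` (U \<inter> fst C))"
    using homeomorphic_imp_open_map[OF hom] unfolding open_map_def by blast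
  then show ?thesis using op openin_open_trans by blast
qed

text \<open>The three charts may belong to different manifolds, so this one chain rule covers
  changes of chart on either side of the inclusion. The two maps agree only over the overlap of
  \<open>c\<close> and \<open>d\<close>, hence the openness premise.\<close>

lemma frechet_derivative_chart_change:
  assumes W: "open (snd c ` (fst c \<inter> fst d))" and p: "p \<in> fst c" "p \<in> fst d"
    and inj: "inj_on (snd c) (fst c)" "inj_on (snd d) (fst d)"
    and diff: "(snd d \<circ> chart_inv c) differentiable (at (snd c p))"
      "(snd e \<circ> chart_inv d) differentiable (at (snd d p))"
  shows "frechet_derivative (snd e \<circ> chart_inv c) (at (snd c p)) v =
    frechet_derivative (snd e \<circ> chart_inv d) (at (snd d p))
      (frechet_derivative (snd d \<circ> chart_inv c) (at (snd c p)) v)"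
proof -
  have cp: "(snd d \<circ> chart_inv c) (snd c p) = snd d p"
    using inj p by (simp add: chart_inv_def)
  have comp: "(snd e \<circ> chart_inv d) \<circ> (snd d \<circ> chart_inv c) differentiable (at (snd c p))"
    using diff cp by (intro differentiable_chain_at) auto
  have "frechet_derivative ((snd e \<circ> chart_inv d) \<circ> (snd d \<circ> chart_inv c)) (at (snd c p)) =
      frechet_derivative (snd e \<circ> chart_inv c) (at (snd c p))"
    by (rule frechet_derivative_transform_within_open[OF comp W])
      (use p inj in \<open>auto simp: chart_inv_def\<close>)
  moreover have "frechet_derivative ((snd e \<circ> chart_inv d) \<circ> (snd d \<circ> chart_inv c)) (at (snd c p)) =
      frechet_derivative (snd e \<circ> chart_inv d) (at (snd d p)) \<circ>
      frechet_derivative (snd d \<circ> chart_inv c) (at (snd c p))"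
    using frechet_derivative_compose[of "snd d \<circ> chart_inv c" "snd c p" "snd e \<circ> chart_inv d"] diff
    unfolding cp by blast
  ultimately show ?thesis by (metis comp_apply)
qed

text \<open>The case \<open>N = M\<close> covers the transition maps of a single manifold.\<close>

locale smooth_inclusion =
  fixes M :: "('a, 'e::euclidean_space) smooth_mfd" and N :: "('a, 'f::euclidean_space) smooth_mfd"
  assumes mfd_M: "smooth_manifold M" and mfd_N: "smooth_manifold N"
    and carrier_subset: "carrier N \<subseteq> carrier M"
    and cont_incl: "continuous_map (topo N) (topo M) (\<lambda>p. p)"
    and smooth_incl: "\<And>c C. c \<in> atlas N \<Longrightarrow> C \<in> atlas M \<Longrightarrow>
      smooth_on (snd c ` (fst c \<inter> fst C)) (snd C \<circ> chart_inv c)"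

lemma smooth_inclusion_refl: "smooth_manifold M \<Longrightarrow> smooth_inclusion M M"
  by unfold_locales (auto simp: smooth_manifold_def)

lemma submanifold_smooth_inclusion: "submanifold M N \<Longrightarrow> smooth_inclusion M N"
  by unfold_locales (auto simp: submanifold_def)

context smooth_inclusion
begin

lemma incl_differentiable:
  assumes "c \<in> atlas N" "C \<in> atlas M" "p \<in> fst c" "p \<in> fst C"
  shows "(snd C \<circ> chart_inv c) differentiable (at (snd c p))"
  using smooth_on_differentiable[OF smooth_incl[OF assms(1,2)]] assms(3,4) by blast

lemma open_overlap:
  assumes "c \<in> atlas N" "C \<in> atlas M"
  shows "open (snd c ` (fst c \<inter> fst C))"
proof -
  have "openin (topo N) {x \<in> carrier N. x \<in> fst C}"
    using cont_incl chart_domain(1)[OF mfd_M assms(2)] by (auto simp: continuous_map)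
  then have "open (snd c ` ({x \<in> carrier N. x \<in> fst C} \<inter> fst c))"
    by (rule open_chart_image[OF mfd_N assms(1)])
  moreover have "{x \<in> carrier N. x \<in> fst C} \<inter> fst c = fst c \<inter> fst C"
    using chart_domain(2)[OF mfd_N assms(1)] by auto
  ultimately show ?thesis by simp
qed

lemma incl_change_target:
  assumes "c \<in> atlas N" "C \<in> atlas M" "C' \<in> atlas M" "p \<in> fst c" "p \<in> fst C" "p \<in> fst C'"
  shows "frechet_derivative (snd C' \<circ> chart_inv c) (at (snd c p)) v =
    frechet_derivative (snd C' \<circ> chart_inv C) (at (snd C p))
      (frechet_derivative (snd C \<circ> chart_inv c) (at (snd c p)) v)"
  by (rule frechet_derivative_chart_change)
    (use assms in \<open>auto intro: open_overlap chart_inj_on[OF mfd_M] chart_inj_on[OF mfd_N]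
      incl_differentiable smooth_inclusion.incl_differentiable[OF smooth_inclusion_refl[OF mfd_M]]\<close>)

lemma incl_change_source:
  assumes "c \<in> atlas N" "c' \<in> atlas N" "C \<in> atlas M" "p \<in> fst c" "p \<in> fst c'" "p \<in> fst C"
  shows "frechet_derivative (snd C \<circ> chart_inv c) (at (snd c p)) v =
    frechet_derivative (snd C \<circ> chart_inv c') (at (snd c' p))
      (frechet_derivative (snd c' \<circ> chart_inv c) (at (snd c p)) v)"
  by (rule frechet_derivative_chart_change)
    (use assms in \<open>auto intro: chart_inj_on[OF mfd_N] incl_differentiable
      smooth_inclusion.incl_differentiable[OF smooth_inclusion_refl[OF mfd_N]]
      smooth_inclusion.open_overlap[OF smooth_inclusion_refl[OF mfd_N]]\<close>)

lemma linear_dincl: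
  assumes "p \<in> carrier N"
  shows "linear (dincl M N p)"
  unfolding dincl_def
  by (rule linear_frechet_derivative, rule incl_differentiable)
    (use assms carrier_subset chart_at_mem[OF mfd_M] chart_at_mem[OF mfd_N] in auto)

text \<open>Frees \<open>dincl\<close> from the preferred charts at the base point: in fixed charts
  it is the Jacobian of the inclusion, and as such it can be differentiated when the point
  varies.\<close>

lemma to_chart_dincl:
  assumes "c \<in> atlas N" "C \<in> atlas M" "p \<in> fst c" "p \<in> fst C"
  shows "to_chart M C p (dincl M N p v) =
    frechet_derivative (snd C \<circ> chart_inv c) (at (snd c p)) (to_chart N c p v)"
proof -
  have p: "p \<in> carrier N" "p \<in> carrier M"
    using chart_domain(2)[OF mfd_N assms(1)] assms(3) carrier_subset by auto
  note at = chart_at_mem[OF mfd_N p(1)] chart_at_mem[OF mfd_M p(2)]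
  show ?thesis
    unfolding to_chart_def dincl_def
    using incl_change_target[OF at(1) at(3) assms(2) at(2) at(4) assms(4)]
      incl_change_source[OF at(1) assms(1,2) at(2) assms(3,4)] by metis
qed

end

context
  fixes M :: "('a, 'e::euclidean_space) smooth_mfd"
  assumes mfd: "smooth_manifold M"
begin

interpretation smooth_inclusion M M by (rule smooth_inclusion_refl[OF mfd])

lemma frechet_derivative_chart_self:
  assumes "C \<in> atlas M" "p \<in> fst C"
  shows "frechet_derivative (snd C \<circ> chart_inv C) (at (snd C p)) = (\<lambda>v. v)"
proof -
  have "frechet_derivative (\<lambda>x. x) (at (snd C p)) = frechet_derivative (snd C \<circ> chart_inv C) (at (snd C p))"
    by (rule frechet_derivative_transform_within_open[OF _ open_overlap[OF assms(1,1)]])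
      (use assms chart_inv_chart[OF mfd assms(1)] in auto)
  then show ?thesis by simp
qed

lemma linear_to_chart:
  assumes "C \<in> atlas M" "p \<in> fst C"
  shows "linear (to_chart M C p)"
  unfolding to_chart_def
  using assms chart_at_mem[OF mfd] chart_domain(2)[OF mfd]
  by (blast intro: linear_frechet_derivative incl_differentiable)

lemma linear_from_chart:
  assumes "C \<in> atlas M" "p \<in> fst C"
  shows "linear (from_chart M C p)"
  unfolding from_chart_def
  using assms chart_at_mem[OF mfd] chart_domain(2)[OF mfd]
  by (blast intro: linear_frechet_derivative incl_differentiable)

lemma from_chart_to_chart:
  assumes "C \<in> atlas M" "p \<in> fst C"
  shows "from_chart M C p (to_chart M C p v) = v"
proof -
  have p: "p \<in> carrier M" using assms(2) chart_domain(2)[OF mfd assms(1)] by blast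
  note at = chart_at_mem[OF mfd p]
  show ?thesis
    unfolding to_chart_def from_chart_def
    using incl_change_target[OF at(1) assms(1) at(1) at(2) assms(2) at(2), of v]
      frechet_derivative_chart_self[OF at] by metis
qed

lemma to_chart_chart_at:
  assumes "p \<in> carrier M"
  shows "to_chart M (chart_at M p) p v = v"
  unfolding to_chart_def using frechet_derivative_chart_self chart_at_mem[OF mfd assms] by metis

lemma from_chart_chart_at:
  assumes "p \<in> carrier M"
  shows "from_chart M (chart_at M p) p v = v"
  unfolding from_chart_def using frechet_derivative_chart_self chart_at_mem[OF mfd assms] by metis

end

section \<open>Sections along the submanifold and their bracket\<close>

lemma dincl_pull: "X p \<in> tangent M N p \<Longrightarrow> dincl M N p (pull M N X p) = X p"
  unfolding pull_def tangent_def by (rule f_inv_into_f)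

context smooth_inclusion
begin

lemma local_rep_chart_at:
  assumes "p \<in> carrier N"
  shows "local_rep M (chart_at N p) (chart_at M p) Y (snd (chart_at N p) p) = Y p"
proof -
  have "p \<in> carrier M" using assms carrier_subset by auto
  then show ?thesis
    unfolding local_rep_def
    using chart_inv_chart[OF mfd_N chart_at_mem[OF mfd_N assms]] to_chart_chart_at[OF mfd_M] by simp
qed

lemma local_rep_pull:
  assumes c: "c \<in> atlas N" "C \<in> atlas M" and x: "x \<in> snd c ` (fst c \<inter> fst C)"
    and Y: "Y (chart_inv c x) \<in> tangent M N (chart_inv c x)"
  shows "local_rep M c C Y x =
    frechet_derivative (snd C \<circ> chart_inv c) (at x) (local_rep N c c (pull M N Y) x)"
proof -
  obtain q where q: "q \<in> fst c" "q \<in> fst C" "x = snd c q" using x by auto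
  have cq: "chart_inv c x = q" using chart_inv_chart[OF mfd_N c(1) q(1)] q(3) by simp
  show ?thesis
    unfolding local_rep_def cq
    using to_chart_dincl[OF c q(1,2)] dincl_pull Y q(3) cq by metis
qed

lemma chart_point:
  assumes "p \<in> carrier N"
  shows "chart_at N p \<in> atlas N" "chart_at M p \<in> atlas M"
    "p \<in> fst (chart_at N p)" "p \<in> fst (chart_at M p)"
    "snd (chart_at N p) p \<in> snd (chart_at N p) ` (fst (chart_at N p) \<inter> fst (chart_at M p))"
proof -
  have "p \<in> carrier M" using assms carrier_subset by auto
  then show "chart_at N p \<in> atlas N" "chart_at M p \<in> atlas M"
    "p \<in> fst (chart_at N p)" "p \<in> fst (chart_at M p)"
    "snd (chart_at N p) p \<in> snd (chart_at N p) ` (fst (chart_at N p) \<inter> fst (chart_at M p))"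
    using chart_at_mem[OF mfd_N assms] chart_at_mem[OF mfd_M] by auto
qed

lemma section_differentiable:
  assumes Y: "Y \<in> sections M N (carrier N) E" and p: "p \<in> carrier N"
  shows "local_rep M (chart_at N p) (chart_at M p) Y differentiable (at (snd (chart_at N p) p))"
proof -
  have "smooth_on (snd (chart_at N p) ` (carrier N \<inter> fst (chart_at N p) \<inter> fst (chart_at M p)))
      (local_rep M (chart_at N p) (chart_at M p) Y)"
    using Y chart_point[OF p] unfolding sections_def by blast
  then show ?thesis
    by (rule smooth_on_differentiable) (use chart_point[OF p] p in blast)
qed

text \<open>In charts a tangent section is the Jacobian \<open>E\<close> applied to its pull-back.
  Differentiating produces the image of the intrinsic derivative and a second derivative of the
  inclusion; in the antisymmetrised expression the latter cancel.\<close>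

lemma dincl_lie_bracket:
  assumes inj: "inj (dincl M N p)" and p: "p \<in> carrier N"
    and Y: "Y \<in> sections M N (carrier N) E" and YT: "\<And>q. q \<in> carrier N \<Longrightarrow> Y q \<in> tangent M N q"
    and Z: "Z \<in> sections M N (carrier N) F" and ZT: "\<And>q. q \<in> carrier N \<Longrightarrow> Z q \<in> tangent M N q"
  shows "dincl M N p (lie_bracket N (pull M N Y) (pull M N Z) p) =
    frechet_derivative (local_rep M (chart_at N p) (chart_at M p) Z) (at (snd (chart_at N p) p)) (pull M N Y p) -
    frechet_derivative (local_rep M (chart_at N p) (chart_at M p) Y) (at (snd (chart_at N p) p)) (pull M N Z p)"
proof -
  define c C x0 where "c = chart_at N p" and "C = chart_at M p" and "x0 = snd c p"
  note defs = c_def C_def x0_def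
  define \<phi> where "\<phi> = snd C \<circ> chart_inv c"
  define S where "S = snd c ` (fst c \<inter> fst C)"
  have cC: "c \<in> atlas N" "C \<in> atlas M" "p \<in> fst c" "x0 \<in> S"
    using chart_point[OF p] by (auto simp: defs S_def)
  have S: "open S" unfolding S_def by (rule open_overlap[OF cC(1,2)])
  define E where "E x = frechet_derivative \<phi> (at x)" for x
  have smooth: "smooth_on S \<phi>" unfolding S_def \<phi>_def by (rule smooth_incl[OF cC(1,2)])
  have E_der: "(\<phi> has_derivative E x) (at x)" if "x \<in> S" for x
    unfolding E_def using smooth_on_differentiable[OF smooth that] frechet_derivative_works by blast
  have linE: "linear (E x)" if "x \<in> S" for x using E_der[OF that] has_derivative_linear by blast
  have E_diff: "(\<lambda>x. E x v) differentiable (at x0)" for v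
    unfolding E_def by (rule smooth_on_differentiable[OF smooth_on_frechet_derivative[OF smooth] cC(4)])
  define E' where "E' v = frechet_derivative (\<lambda>x. E x v) (at x0)" for v
  have E': "((\<lambda>x. E x v) has_derivative E' v) (at x0)" for v
    unfolding E'_def using E_diff frechet_derivative_works by blast
  have Ex0: "E x0 = dincl M N p" by (simp add: E_def dincl_def \<phi>_def defs)
  have main: "local_rep N c c (pull M N X) differentiable (at x0) \<and>
      frechet_derivative (local_rep M c C X) (at x0) =
        (\<lambda>h. E' (pull M N X p) h + E x0 (frechet_derivative (local_rep N c c (pull M N X)) (at x0) h))"
    if X: "X \<in> sections M N (carrier N) F" and XT: "\<And>q. q \<in> carrier N \<Longrightarrow> X q \<in> tangent M N q" for X F
  proof -
    define z where "z = local_rep N c c (pull M N X)"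
    have eq: "local_rep M c C X x = E x (z x)" if "x \<in> S" for x
    proof -
      have "chart_inv c x \<in> carrier N"
        using that chart_inv_chart[OF mfd_N cC(1)] chart_domain(2)[OF mfd_N cC(1)]
        unfolding S_def by auto
      then show ?thesis
        using local_rep_pull[OF cC(1,2)] that XT unfolding E_def z_def \<phi>_def S_def by blast
    qed
    have diff: "local_rep M c C X differentiable (at x0)"
      using section_differentiable[OF X p] by (simp add: defs)
    then obtain d where d: "(local_rep M c C X has_derivative d) (at x0)"
      unfolding differentiable_def by blast
    have "((\<lambda>x. E x (z x)) has_derivative d) (at x0)"
      by (rule has_derivative_transform_within_open[OF d S cC(4)]) (rule eq)
    then have "(\<lambda>x. E x (z x)) differentiable (at x0)" unfolding differentiable_def by blast
    \<comment> \<open>Smoothness is known only for the ambient components, and injectivity of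
      \<open>E x0\<close> transfers differentiability back to the pull-back.\<close>
    then have z_diff: "z differentiable (at x0)"
      using differentiable_cancel_linear[OF S cC(4) linE E_diff] inj Ex0 by simp
    have "((\<lambda>x. E x (z x)) has_derivative (\<lambda>h. E' (z x0) h + E x0 (frechet_derivative z (at x0) h))) (at x0)"
      by (rule has_derivative_apply[OF S cC(4) linE E']) (use z_diff frechet_derivative_works in blast)+
    then have "(local_rep M c C X has_derivative (\<lambda>h. E' (z x0) h + E x0 (frechet_derivative z (at x0) h))) (at x0)"
      by (rule has_derivative_transform_within_open[OF _ S cC(4)]) (simp add: eq)
    then have "frechet_derivative (local_rep M c C X) (at x0) =
        (\<lambda>h. E' (z x0) h + E x0 (frechet_derivative z (at x0) h))"
      using frechet_derivative_at by metis
    moreover have "z x0 = pull M N X p"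
      using smooth_inclusion.local_rep_chart_at[OF smooth_inclusion_refl[OF mfd_N] p]
      by (simp add: z_def defs)
    ultimately show ?thesis using z_diff by (simp add: z_def)
  qed
  have sym: "E' (pull M N Z p) (pull M N Y p) = E' (pull M N Y p) (pull M N Z p)"
    by (rule symmetric_second_derivative[OF S cC(4) E_der E' E'])
  show ?thesis
    using main[OF Y YT] main[OF Z ZT] sym linE[OF cC(4)]
    unfolding lie_bracket_def Let_def
    by (simp add: Ex0 linear_diff flip: defs)
qed

end

section \<open>The Levi-Civita connection\<close>

text \<open>Makes the first-kind Christoffel expression linear in its last argument, so that the
  metric can represent it by a vector.\<close>

lemma linear_frechet_derivative_parameter:
  assumes S: "open S" "x \<in> S" and lin: "\<And>y. y \<in> S \<Longrightarrow> linear (\<lambda>w. h w y)"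
    and diff: "\<And>w. h w differentiable (at x)"
  shows "linear (\<lambda>w. frechet_derivative (h w) (at x) a)"
proof (rule linearI)
  note D = frechet_derivative_works[THEN iffD1, OF diff]
  show "frechet_derivative (h (v + w)) (at x) a = frechet_derivative (h v) (at x) a + frechet_derivative (h w) (at x) a" for v w
  proof -
    have "(h (v + w) has_derivative (\<lambda>a. frechet_derivative (h v) (at x) a + frechet_derivative (h w) (at x) a)) (at x)"
      by (rule has_derivative_transform_within_open[OF has_derivative_add[OF D D] S])
        (use lin linear_add in fastforce)
    then show ?thesis using frechet_derivative_at by metis
  qed
  show "frechet_derivative (h (c *\<^sub>R w)) (at x) a = c *\<^sub>R frechet_derivative (h w) (at x) a" for c w
  proof -
    have "(h (c *\<^sub>R w) has_derivative (\<lambda>a. c *\<^sub>R frechet_derivative (h w) (at x) a)) (at x)"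
      by (rule has_derivative_transform_within_open[OF has_derivative_scaleR_right[OF D] S])
        (use lin linear_scale in fastforce)
    then show ?thesis using frechet_derivative_at by metis
  qed
qed

section \<open>Nondegenerate bilinear forms\<close>

text \<open>\<open>G\<close> is the Gram operator of \<open>b\<close> with respect to the Euclidean
  inner product. Through it, Riesz representation and the dimension of complements carry over to
  indefinite forms.\<close>

lemma bilinear_eq_inner:
  fixes b :: "'e::euclidean_space \<Rightarrow> 'e \<Rightarrow> real"
  assumes "bilinear b" "nondegenerate_on b UNIV"
  obtains G where "linear G" "inj G" "\<And>u v. b u v = G u \<bullet> v"
proof
  define G where "G u = (\<Sum>i\<in>Basis. b u i *\<^sub>R i)" for u
  have lin1: "linear (\<lambda>u. b u v)" and lin2: "linear (b u)" for u v
    using assms(1) by (auto simp: bilinear_def)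
  show b: "b u v = G u \<bullet> v" for u v
    using linear_eq_sum_Basis[OF lin2, of u v]
    unfolding G_def inner_sum_left inner_scaleR_left by (simp add: mult.commute inner_commute)
  show lin: "linear G"
    unfolding G_def
    by (rule linearI) (simp_all add: linear_add[OF lin1] linear_scale[OF lin1] scaleR_add_left
        sum.distrib scaleR_sum_right)
  show "inj G"
    using assms(2) b unfolding linear_injective_0[OF lin] nondegenerate_on_def by simp
qed

lemma nondegenerate_eqI:
  assumes "bilinear b" "nondegenerate_on b UNIV" "\<And>w. b u w = b v w"
  shows "u = v"
proof -
  have "b (u - v) w = 0" for w
    using assms(3) bilinear_lsub[OF assms(1)] by simp
  then have "u - v = 0" using assms(2) unfolding nondegenerate_on_def by blast
  then show ?thesis by simp
qed

lemma nondegenerate_represent: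
  fixes b :: "'e::euclidean_space \<Rightarrow> 'e \<Rightarrow> real"
  assumes "bilinear b" "nondegenerate_on b UNIV" "linear F"
  shows "\<exists>z. \<forall>w. b z w = F w"
proof -
  obtain G where G: "linear G" "inj G" "\<And>u v. b u v = G u \<bullet> v"
    using bilinear_eq_inner[OF assms(1,2)] by metis
  obtain z where "G z = (\<Sum>i\<in>Basis. F i *\<^sub>R i)"
    using linear_inj_imp_surj[OF G(1,2)] by (metis surjD)
  then have "b z w = F w" for w
    using linear_eq_sum_Basis[OF assms(3), of w] \<open>G z = _\<close>
    unfolding G(3) by (simp only: inner_sum_left inner_scaleR_left) (simp add: mult.commute inner_commute)
  then show ?thesis by blast
qed

text \<open>\<open>G\<close> maps the complement for \<open>b\<close> bijectively onto the Euclidean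
  one, so the dimensions add up even when \<open>T\<close> meets its complement, as it does for a
  lightlike tangent space.\<close>

lemma dim_bilinear_complement:
  fixes b :: "'e::euclidean_space \<Rightarrow> 'e \<Rightarrow> real"
  assumes "bilinear b" "nondegenerate_on b UNIV" "subspace T"
  shows "dim {v. \<forall>u\<in>T. b v u = 0} + dim T = DIM('e)"
proof -
  obtain G where G: "linear G" "inj G" "\<And>u v. b u v = G u \<bullet> v"
    using bilinear_eq_inner[OF assms(1,2)] by metis
  have surj: "surj G" by (rule linear_inj_imp_surj[OF G(1,2)])
  let ?A = "{v. \<forall>u\<in>T. b v u = 0}"
  have "G ` ?A = {y \<in> UNIV. \<forall>x\<in>T. orthogonal x y}"
  proof (intro set_eqI iffI)
    fix y assume y: "y \<in> {y \<in> UNIV. \<forall>x\<in>T. orthogonal x y}"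
    obtain v where v: "y = G v" using surj by (rule surjE)
    have "b v u = 0" if "u \<in> T" for u
      using y that unfolding G(3) v orthogonal_def by (simp add: inner_commute)
    then show "y \<in> G ` ?A" using v by blast
  qed (auto simp: G(3) orthogonal_def inner_commute)
  moreover have "dim (G ` ?A) = dim ?A"
    using G(1,2) by (intro dim_image_eq) (auto intro: inj_on_subset)
  ultimately have "dim ?A + dim T = dim (UNIV :: 'e set)"
    using dim_subspace_orthogonal_to_vectors[OF assms(3) subspace_UNIV subset_UNIV] by simp
  then show ?thesis by simp
qed

section \<open>Christoffel symbols of a semi-Riemannian metric\<close>

locale semi_riemannian_metric =
  fixes M :: "('a, 'e::euclidean_space) smooth_mfd" and g :: "'a \<Rightarrow> 'e \<Rightarrow> 'e \<Rightarrow> real" and q :: nat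
  assumes semi_riemannian: "semi_riemannian M g q"
begin

lemma mfd: "smooth_manifold M"
  using semi_riemannian unfolding semi_riemannian_def by blast

lemma metric:
  assumes "p \<in> carrier M"
  shows "bilinear (g p)" "g p u v = g p v u" "nondegenerate_on (g p) UNIV"
  using semi_riemannian assms unfolding semi_riemannian_def by blast+

lemma metric_linear:
  assumes "p \<in> carrier M"
  shows "linear (\<lambda>u. g p u v)" "linear (g p u)"
  using metric(1)[OF assms] by (auto simp: bilinear_def)

lemma open_chart_range:
  assumes "C \<in> atlas M" shows "open (snd C ` fst C)"
  using mfd assms unfolding smooth_manifold_def by blast

lemma metric_rep_differentiable:
  assumes "C \<in> atlas M" "p \<in> fst C"
  shows "metric_rep M C g u v differentiable (at (snd C p))"
proof -
  have "smooth_on (snd C ` fst C) (metric_rep M C g u v)"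
    using semi_riemannian assms(1) unfolding semi_riemannian_def by blast
  then show ?thesis by (rule smooth_on_differentiable) (use assms(2) in blast)
qed

lemma chart_inv_mem:
  assumes "C \<in> atlas M" "y \<in> snd C ` fst C"
  shows "chart_inv C y \<in> fst C" "chart_inv C y \<in> carrier M"
  using assms chart_inv_chart[OF mfd assms(1)] chart_domain(2)[OF mfd assms(1)] by auto

lemma metric_rep_linear:
  assumes "C \<in> atlas M" "y \<in> snd C ` fst C"
  shows "linear (\<lambda>w. metric_rep M C g v w y)"
  unfolding metric_rep_def Let_def
  using linear_compose[OF linear_from_chart[OF mfd assms(1) chart_inv_mem(1)[OF assms]]
      metric_linear(2)[OF chart_inv_mem(2)[OF assms]]]
  by (simp add: o_def)

lemma metric_rep_commute:
  assumes "C \<in> atlas M" "y \<in> snd C ` fst C"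
  shows "metric_rep M C g u v y = metric_rep M C g v u y"
  unfolding metric_rep_def Let_def using metric(2)[OF chart_inv_mem(2)[OF assms]] by blast

lemma frechet_metric_rep_commute:
  assumes "C \<in> atlas M" "p \<in> fst C"
  shows "frechet_derivative (metric_rep M C g u v) (at (snd C p)) =
    frechet_derivative (metric_rep M C g v u) (at (snd C p))"
  by (rule frechet_derivative_transform_within_open[OF metric_rep_differentiable[OF assms]
      open_chart_range[OF assms(1)]]) (use assms metric_rep_commute in auto)

lemma linear_frechet_metric_rep:
  assumes "C \<in> atlas M" "p \<in> fst C"
  shows "linear (\<lambda>w. frechet_derivative (metric_rep M C g v w) (at (snd C p)) a)"
    "linear (\<lambda>v. frechet_derivative (metric_rep M C g v w) (at (snd C p)) a)"
    "linear (\<lambda>a. frechet_derivative (metric_rep M C g v w) (at (snd C p)) a)"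
proof -
  show *: "linear (\<lambda>w. frechet_derivative (metric_rep M C g v w) (at (snd C p)) a)" for v
    by (rule linear_frechet_derivative_parameter[OF open_chart_range[OF assms(1)] _
          metric_rep_linear[OF assms(1)] metric_rep_differentiable[OF assms]]) (use assms in auto)
  show "linear (\<lambda>v. frechet_derivative (metric_rep M C g v w) (at (snd C p)) a)"
    using *[of w] unfolding frechet_metric_rep_commute[OF assms, of w] .
  show "linear (\<lambda>a. frechet_derivative (metric_rep M C g v w) (at (snd C p)) a)"
    using linear_frechet_derivative[OF metric_rep_differentiable[OF assms]] .
qed

text \<open>The right-hand side is linear in \<open>w\<close>, so nondegeneracy provides exactly one
  representing vector and the definite description is meaningful.\<close>

lemma christoffel:
  assumes p: "p \<in> carrier M"
  shows "2 * g p (christoffel M g p u v) w =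
    frechet_derivative (metric_rep M (chart_at M p) g v w) (at (snd (chart_at M p) p)) u +
    frechet_derivative (metric_rep M (chart_at M p) g u w) (at (snd (chart_at M p) p)) v -
    frechet_derivative (metric_rep M (chart_at M p) g u v) (at (snd (chart_at M p) p)) w"
proof -
  note C = chart_at_mem[OF mfd p]
  define K where "K w =
    frechet_derivative (metric_rep M (chart_at M p) g v w) (at (snd (chart_at M p) p)) u +
    frechet_derivative (metric_rep M (chart_at M p) g u w) (at (snd (chart_at M p) p)) v -
    frechet_derivative (metric_rep M (chart_at M p) g u v) (at (snd (chart_at M p) p)) w" for w
  have K: "linear K"
    unfolding K_def
    by (intro linear_compose_sub linear_compose_add linear_frechet_metric_rep[OF C])
  then have "linear (\<lambda>w. (1/2) *\<^sub>R K w)" by (rule linear_compose_scale_right)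
  then obtain z where "\<forall>w. g p z w = (1/2) *\<^sub>R K w"
    using nondegenerate_represent[OF metric(1,3)[OF p]] by blast
  then have z: "\<forall>w. 2 * g p z w = K w" by (simp add: mult.commute)
  have "\<forall>w. 2 * g p (THE z. \<forall>w. 2 * g p z w = K w) w = K w"
  proof (rule theI[of "\<lambda>z. \<forall>w. 2 * g p z w = K w"])
    show "\<forall>w. 2 * g p z w = K w" by (rule z)
    show "z' = z" if "\<forall>w. 2 * g p z' w = K w" for z'
    proof (rule nondegenerate_eqI[OF metric(1,3)[OF p]])
      fix w show "g p z' w = g p z w"
        using that[rule_format, of w] z[rule_format, of w] by linarith
    qed
  qed
  then show ?thesis unfolding christoffel_def Let_def K_def by blast
qed

lemma christoffel_commute:
  assumes p: "p \<in> carrier M"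
  shows "christoffel M g p u v = christoffel M g p v u"
proof (rule nondegenerate_eqI[OF metric(1,3)[OF p]])
  fix w
  show "g p (christoffel M g p u v) w = g p (christoffel M g p v u) w"
    using christoffel[OF p, of u v w] christoffel[OF p, of v u w]
      frechet_metric_rep_commute[OF chart_at_mem[OF mfd p], of u v] by simp
qed

lemma christoffel_add_right:
  assumes p: "p \<in> carrier M"
  shows "christoffel M g p u (v + v') = christoffel M g p u v + christoffel M g p u v'"
proof (rule nondegenerate_eqI[OF metric(1,3)[OF p]])
  fix w
  note C = chart_at_mem[OF mfd p]
  show "g p (christoffel M g p u (v + v')) w = g p (christoffel M g p u v + christoffel M g p u v') w"
    using christoffel[OF p, of u "v + v'" w] christoffel[OF p, of u v w] christoffel[OF p, of u v' w]
    by (simp add: linear_add[OF linear_frechet_metric_rep(1)[OF C]]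
        linear_add[OF linear_frechet_metric_rep(2)[OF C]]
        linear_add[OF linear_frechet_metric_rep(3)[OF C]] bilinear_ladd[OF metric(1)[OF p]])
qed

end

section \<open>The Levi-Civita derivative of sections along the submanifold\<close>

locale semi_riemannian_inclusion = smooth_inclusion M N + semi_riemannian_metric M g q
  for M :: "('a, 'e::euclidean_space) smooth_mfd" and N :: "('a, 'f::euclidean_space) smooth_mfd" and g q
begin

lemma carrierD: "p \<in> carrier N \<Longrightarrow> p \<in> carrier M"
  using carrier_subset by blast

lemma levi_civita_torsion_free:
  assumes "inj (dincl M N p)" and p: "p \<in> carrier N"
    and "Y \<in> sections M N (carrier N) E" "\<And>q. q \<in> carrier N \<Longrightarrow> Y q \<in> tangent M N q"
    and "Z \<in> sections M N (carrier N) F" "\<And>q. q \<in> carrier N \<Longrightarrow> Z q \<in> tangent M N q"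
  shows "dincl M N p (lie_bracket N (pull M N Y) (pull M N Z) p) =
    levi_civita M N g Y Z p - levi_civita M N g Z Y p"
  using dincl_lie_bracket[OF assms] christoffel_commute[OF carrierD[OF p], of "Y p" "Z p"]
  by (simp add: levi_civita_def Let_def)

text \<open>\<open>W\<close> is prescribed by its values on the carrier only, since
  \<open>JZ = fZ + wZ\<close> is available only there; its local representation inherits
  differentiability from the summands.\<close>

lemma levi_civita_add:
  assumes p: "p \<in> carrier N"
    and Y: "Y \<in> sections M N (carrier N) E" and Z: "Z \<in> sections M N (carrier N) F"
    and W: "\<And>q. q \<in> carrier N \<Longrightarrow> W q = Y q + Z q"
  shows "levi_civita M N g X W p = levi_civita M N g X Y p + levi_civita M N g X Z p"
proof -
  define c C x0 where "c = chart_at N p" and "C = chart_at M p" and "x0 = snd c p"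
  note defs = c_def C_def x0_def
  define S where "S = snd c ` (fst c \<inter> fst C)"
  have cC: "c \<in> atlas N" "C \<in> atlas M" "p \<in> fst c" "x0 \<in> S"
    using chart_point[OF p] by (auto simp: defs S_def)
  have S: "open S" unfolding S_def by (rule open_overlap[OF cC(1,2)])
  have D: "(local_rep M c C A has_derivative frechet_derivative (local_rep M c C A) (at x0)) (at x0)"
    if "A \<in> sections M N (carrier N) H" for A H
    using section_differentiable[OF that p] frechet_derivative_works unfolding defs by blast
  have eq: "local_rep M c C Y x + local_rep M c C Z x = local_rep M c C W x" if x: "x \<in> S" for x
  proof -
    obtain q where q: "q \<in> fst c" "q \<in> fst C" "x = snd c q" using x unfolding S_def by auto
    have "chart_inv c x = q" using chart_inv_chart[OF mfd_N cC(1) q(1)] q(3) by simp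
    moreover have "q \<in> carrier N" using chart_domain(2)[OF mfd_N cC(1)] q(1) by blast
    ultimately show ?thesis
      unfolding local_rep_def using W linear_add[OF linear_to_chart[OF mfd cC(2) q(2)]] by simp
  qed
  have "(local_rep M c C W has_derivative (\<lambda>h. frechet_derivative (local_rep M c C Y) (at x0) h +
      frechet_derivative (local_rep M c C Z) (at x0) h)) (at x0)"
    by (rule has_derivative_transform_within_open[OF has_derivative_add[OF D[OF Y] D[OF Z]] S cC(4) eq])
  then have "frechet_derivative (local_rep M c C W) (at x0) = (\<lambda>h. frechet_derivative (local_rep M c C Y) (at x0) h +
      frechet_derivative (local_rep M c C Z) (at x0) h)"
    using frechet_derivative_at by metis
  then show ?thesis
    unfolding levi_civita_def Let_def
    using W[OF p] christoffel_add_right[OF carrierD[OF p]] by (simp flip: defs)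
qed

text \<open>The product rule leaves the derivative of \<open>J\<close> along the inclusion and two
  Christoffel terms; by the chain rule these form the ambient covariant derivative of
  \<open>J\<close> in the direction \<open>X p\<close>, which vanishes.\<close>

lemma levi_civita_parallel:
  assumes J: "\<And>q. q \<in> carrier M \<Longrightarrow> linear (J q)"
    and smooth: "\<And>C u. C \<in> atlas M \<Longrightarrow> smooth_on (snd C ` fst C) (endo_rep M C J u)"
    and par: "\<And>u v. nabla_endo M g J p v u = 0"
    and p: "p \<in> carrier N" and X: "X p \<in> tangent M N p"
    and Z: "Z \<in> sections M N (carrier N) E"
  shows "levi_civita M N g X (\<lambda>q. J q (Z q)) p = J p (levi_civita M N g X Z p)"
proof -
  define c C x0 where "c = chart_at N p" and "C = chart_at M p" and "x0 = snd c p"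
  note defs = c_def C_def x0_def
  define S where "S = snd c ` (fst c \<inter> fst C)"
  define \<phi> where "\<phi> = snd C \<circ> chart_inv c"
  define z where "z = local_rep M c C Z"
  \<comment> \<open>The endomorphism field along the submanifold: components in the ambient chart,
    argument in the coordinates of \<open>c\<close>.\<close>
  define E where "E x v = endo_rep M C J v (\<phi> x)" for x v
  have cC: "c \<in> atlas N" "C \<in> atlas M" "p \<in> fst c" "p \<in> fst C" "x0 \<in> S"
    using chart_point[OF p] by (auto simp: defs S_def)
  have pM: "p \<in> carrier M" by (rule carrierD[OF p])
  have S: "open S" unfolding S_def by (rule open_overlap[OF cC(1,2)])
  have \<phi>0: "\<phi> x0 = snd C p" using chart_inv_chart[OF mfd_N cC(1,3)] by (simp add: \<phi>_def x0_def)
  have point: "\<exists>q. q \<in> fst C \<and> q \<in> carrier M \<and> chart_inv c x = q \<and> chart_inv C (\<phi> x) = q" if x: "x \<in> S" for x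
  proof -
    obtain q where q: "q \<in> fst c" "q \<in> fst C" "x = snd c q" using x unfolding S_def by auto
    then show ?thesis
      using chart_inv_chart[OF mfd_N cC(1) q(1)] chart_inv_chart[OF mfd cC(2) q(2)]
        chart_domain(2)[OF mfd cC(2)] by (auto simp: \<phi>_def)
  qed
  have linE: "linear (E x)" if x: "x \<in> S" for x
  proof -
    obtain q where q: "q \<in> fst C" "q \<in> carrier M" "chart_inv C (\<phi> x) = q" using point[OF x] by blast
    have "linear (to_chart M C q \<circ> (J q \<circ> from_chart M C q))"
      by (intro linear_compose linear_from_chart[OF mfd cC(2) q(1)] linear_to_chart[OF mfd cC(2) q(1)] J q(2))
    moreover have "E x = to_chart M C q \<circ> (J q \<circ> from_chart M C q)"
      by (simp add: fun_eq_iff E_def endo_rep_def Let_def q(3))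
    ultimately show ?thesis by simp
  qed
  define E' where "E' v h = frechet_derivative (endo_rep M C J v) (at (snd C p)) (frechet_derivative \<phi> (at x0) h)" for v h
  have E': "((\<lambda>x. E x v) has_derivative E' v) (at x0)" for v
  proof -
    have 1: "(\<phi> has_derivative frechet_derivative \<phi> (at x0)) (at x0)"
      using incl_differentiable[OF cC(1-4)] frechet_derivative_works unfolding \<phi>_def x0_def by blast
    have "endo_rep M C J v differentiable (at (snd C p))"
      by (rule smooth_on_differentiable[OF smooth[OF cC(2)]]) (use cC in blast)
    then have "(endo_rep M C J v has_derivative frechet_derivative (endo_rep M C J v) (at (\<phi> x0))) (at (\<phi> x0))"
      using frechet_derivative_works \<phi>0 by metis
    from has_derivative_compose[OF 1 this] show ?thesis
      unfolding E_def E'_def \<phi>0 .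
  qed
  have z': "(z has_derivative frechet_derivative z (at x0)) (at x0)"
    using section_differentiable[OF Z p] frechet_derivative_works unfolding defs z_def by blast
  have eq: "E x (z x) = local_rep M c C (\<lambda>q. J q (Z q)) x" if x: "x \<in> S" for x
  proof -
    obtain q where q: "q \<in> fst C" "chart_inv c x = q" "chart_inv C (\<phi> x) = q" using point[OF x] by blast
    then show ?thesis
      unfolding E_def z_def endo_rep_def local_rep_def Let_def
      using from_chart_to_chart[OF mfd cC(2) q(1)] by simp
  qed
  have "(local_rep M c C (\<lambda>q. J q (Z q)) has_derivative
      (\<lambda>h. E' (z x0) h + E x0 (frechet_derivative z (at x0) h))) (at x0)"
    by (rule has_derivative_transform_within_open[OF has_derivative_apply[OF S cC(5) linE E' z'] S cC(5) eq])
  then have der: "frechet_derivative (local_rep M c C (\<lambda>q. J q (Z q))) (at x0) =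
      (\<lambda>h. E' (z x0) h + E x0 (frechet_derivative z (at x0) h))"
    using frechet_derivative_at by metis
  have z0: "z x0 = Z p" using local_rep_chart_at[OF p] by (simp add: z_def defs)
  have E0: "E x0 v = J p v" for v
    unfolding E_def endo_rep_def Let_def \<phi>0 chart_inv_chart[OF mfd cC(2,4)]
    using to_chart_chart_at[OF mfd pM] from_chart_chart_at[OF mfd pM] by (simp add: C_def)
  have "frechet_derivative \<phi> (at x0) = dincl M N p" by (simp add: dincl_def \<phi>_def defs)
  then have E'0: "E' (z x0) (pull M N X p) = frechet_derivative (endo_rep M C J (Z p)) (at (snd C p)) (X p)"
    using dincl_pull[where X = X, OF X] by (simp add: E'_def z0)
  have "frechet_derivative (endo_rep M C J (Z p)) (at (snd C p)) (X p) + christoffel M g p (X p) (J p (Z p)) =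
      J p (christoffel M g p (X p) (Z p))"
    using par[of "X p" "Z p"] unfolding nabla_endo_def Let_def C_def[symmetric] by simp
  then show ?thesis
    unfolding levi_civita_def Let_def
    using der E0 E'0 linear_add[OF J[OF pM]] by (simp add: z_def flip: defs)
qed

end

section \<open>Splittings of the tangent spaces\<close>

lemma subspace_sum_of: "subspace A \<Longrightarrow> subspace B \<Longrightarrow> subspace (sum_of A B)"
  using subspace_sums[of A B] by (simp add: sum_of_def)

lemma comp_in_unique:
  assumes "subspace A" "subspace B" "A \<inter> B = {0}" "a \<in> A" "v - a \<in> B"
  shows "comp_in A B v = a"
  unfolding comp_in_def
proof (rule the_equality)
  show "a \<in> A \<and> v - a \<in> B" using assms by simp
  fix a' assume a': "a' \<in> A \<and> v - a' \<in> B"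
  have "a - a' \<in> A" using assms a' by (simp add: subspace_diff)
  moreover have "(v - a') - (v - a) \<in> B" using assms a' subspace_diff by blast
  ultimately have "a - a' \<in> A \<inter> B" by simp
  then show "a' = a" using assms(3) by simp
qed

text \<open>\<open>V\<close> may be a proper subspace, and outside it \<open>comp_in\<close> is an
  unspecified value; the laws for components therefore carry membership premises.\<close>

locale splitting =
  fixes V A B :: "'e::real_vector set"
  assumes A: "subspace A" and B: "subspace B" and sum: "direct_sum V A B"
begin

lemma disjoint: "A \<inter> B = {0}"
  using sum by (simp add: direct_sum_def)

lemma swap: "splitting V B A"
  using A B sum by unfold_locales (auto simp: direct_sum_def sum_of_def, (metis add.commute)+)

lemma sumI: "a \<in> A \<Longrightarrow> b \<in> B \<Longrightarrow> a + b \<in> V"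
  using sum by (auto simp: direct_sum_def sum_of_def)

lemma sumE:
  assumes "v \<in> V" obtains a b where "a \<in> A" "b \<in> B" "v = a + b"
  using assms sum by (auto simp: direct_sum_def sum_of_def)

lemma parts_subset: "A \<subseteq> V" "B \<subseteq> V"
  using sumI[of _ 0] sumI[of 0] subspace_0[OF A] subspace_0[OF B] by force+

lemma subspace: "subspace V"
  using sum subspace_sum_of[OF A B] by (simp add: direct_sum_def)

lemma comp_eq: "a \<in> A \<Longrightarrow> b \<in> B \<Longrightarrow> comp_in A B (a + b) = a"
  by (rule comp_in_unique[OF A B disjoint]) auto

lemma comp_eq_self: "a \<in> A \<Longrightarrow> comp_in A B a = a"
  using comp_eq[of a 0] subspace_0[OF B] by simp

lemma comp_mem: "v \<in> V \<Longrightarrow> comp_in A B v \<in> A" "v \<in> V \<Longrightarrow> v - comp_in A B v \<in> B"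
  using comp_eq by (auto elim!: sumE)

lemma comp_add: "u \<in> V \<Longrightarrow> v \<in> V \<Longrightarrow> comp_in A B (u + v) = comp_in A B u + comp_in A B v"
  using comp_mem[of u] comp_mem[of v] subspace_add[OF A] subspace_add[OF B]
  by (intro comp_in_unique[OF A B disjoint]) (metis, metis add_diff_add)

lemma comp_scale: "v \<in> V \<Longrightarrow> comp_in A B (c *\<^sub>R v) = c *\<^sub>R comp_in A B v"
  using comp_mem[of v] subspace_scale[OF A] subspace_scale[OF B]
  by (intro comp_in_unique[OF A B disjoint]) (metis, metis scaleR_diff_right)

lemma comp_diff: "u \<in> V \<Longrightarrow> v \<in> V \<Longrightarrow> comp_in A B (u - v) = comp_in A B u - comp_in A B v"
  using comp_add[of u "(-1) *\<^sub>R v"] comp_scale[of v "-1"] subspace_scale[OF subspace, of v "-1"] by simp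

lemma comp_sum_eq:
  assumes "v \<in> V" shows "comp_in A B v + comp_in B A v = v"
proof -
  interpret s: splitting V B A by (rule swap)
  show ?thesis
    using comp_eq s.comp_eq assms by (auto elim!: sumE) (metis add.commute)
qed

end

lemma distribution_subspace:
  "distribution M N k E \<Longrightarrow> p \<in> carrier N \<Longrightarrow> subspace (E p)"
  "distribution M N k E \<Longrightarrow> p \<in> carrier N \<Longrightarrow> dim (E p) = k"
  by (auto simp: distribution_def)

section \<open>The transversal bundle\<close>

text \<open>The local frames of \<open>ltr\<close> and \<open>Rad\<close> are dual, so the pairings
  of \<open>n\<close> with the radical frame are its coefficients in the transversal frame.\<close>

lemma ltr_pairing_eq_0:
  assumes lt: "lightlike_transversal D r" and p: "p \<in> carrier (submfd D)"
    and bil: "bilinear (metric D p)" and n: "n \<in> ltr D p"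
    and zero: "\<And>\<xi>. \<xi> \<in> Rad D p \<Longrightarrow> metric D p n \<xi> = 0"
  shows "n = 0"
proof -
  obtain \<xi> N where Rad: "Rad D p = span ((\<lambda>i. \<xi> i p) ` {..<r})"
    and ltr: "ltr D p = span ((\<lambda>i. N i p) ` {..<r})"
    and delta: "\<And>i j. i < r \<Longrightarrow> j < r \<Longrightarrow> metric D p (N i p) (\<xi> j p) = (if i = j then 1 else 0)"
    using lt p unfolding lightlike_transversal_def by metis
  have lin: "linear (\<lambda>v. metric D p v u)" for u using bil by (simp add: bilinear_def)
  have "n \<in> span ((\<lambda>i. N i p) ` {..<r})" using n ltr by simp
  then have "n = (\<Sum>j<r. metric D p n (\<xi> j p) *\<^sub>R N j p)"
  proof (rule span_induct)
    show "subspace {n. n = (\<Sum>j<r. metric D p n (\<xi> j p) *\<^sub>R N j p)}"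
      unfolding subspace_def
      by (auto simp: linear_0[OF lin] linear_add[OF lin] linear_scale[OF lin] scaleR_add_left
          sum.distrib simp flip: scaleR_scaleR scaleR_sum_right)
    fix v assume "v \<in> (\<lambda>i. N i p) ` {..<r}"
    then obtain i where i: "i < r" "v = N i p" by auto
    have "(\<Sum>j<r. metric D p (N i p) (\<xi> j p) *\<^sub>R N j p) = (\<Sum>j<r. if i = j then N j p else 0)"
      by (rule sum.cong) (use delta i in auto)
    also have "\<dots> = N i p" using i by simp
    finally show "v = (\<Sum>j<r. metric D p v (\<xi> j p) *\<^sub>R N j p)" using i by simp
  qed
  also have "\<dots> = 0"
    by (rule sum.neutral) (use zero Rad in \<open>auto intro: span_base\<close>)
  finally show ?thesis .
qed

lemma lightlike_submanifoldD:
  assumes "lightlike_submanifold D r"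
  shows "submanifold (amb D) (submfd D)" "lightlike_transversal D r"
    and "distribution (amb D) (submfd D) r (Rad D)"
    and "\<exists>k. distribution (amb D) (submfd D) k (scr D)"
    and "\<exists>k. distribution (amb D) (submfd D) k (scrperp D)"
    and "\<And>p. p \<in> carrier (submfd D) \<Longrightarrow> direct_sum (tan_sp D p) (Rad D p) (scr D p)"
    and "\<And>p. p \<in> carrier (submfd D) \<Longrightarrow> direct_sum (perp_sp D p) (Rad D p) (scrperp D p)"
  using assms unfolding lightlike_submanifold_def by (elim conjE; simp)+

text \<open>\<open>ltr\<close> and \<open>Rad\<close> both have rank \<open>r\<close>, so
  \<open>tr\<close> has the dimension of the normal space, which is complementary to that of the
  tangent space. It remains to see that the two spaces meet only in zero.\<close>

lemma tangent_transversal_splitting: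
  fixes D :: "('a, 'e::euclidean_space, 'f::euclidean_space) lightlike_data"
  assumes ll: "lightlike_submanifold D r" and p: "p \<in> carrier (submfd D)"
    and bil: "bilinear (metric D p)" and sym: "\<And>u v. metric D p u v = metric D p v u"
    and nondeg: "nondegenerate_on (metric D p) UNIV"
  shows "splitting UNIV (tan_sp D p) (tr D p)"
proof
  have sub: "submanifold (amb D) (submfd D)" and lt: "lightlike_transversal D r"
    and dR: "distribution (amb D) (submfd D) r (Rad D)"
    and dsP: "direct_sum (perp_sp D p) (Rad D p) (scrperp D p)"
    and P: "subspace (scrperp D p)"
    using lightlike_submanifoldD(1,2,3,5,7)[OF ll] p distribution_subspace(1)[OF _ p] by blast+
  interpret smooth_inclusion "amb D" "submfd D" by (rule submanifold_smooth_inclusion[OF sub])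
  have dl: "distribution (amb D) (submfd D) r (ltr D)" using lt by (simp add: lightlike_transversal_def)
  note L = distribution_subspace[OF dl p] and R = distribution_subspace[OF dR p]
  interpret perp: splitting "perp_sp D p" "Rad D p" "scrperp D p"
    using R(1) P dsP by unfold_locales
  show T: "subspace (tan_sp D p)"
    unfolding tangent_def by (rule linear_subspace_image[OF linear_dincl[OF p] subspace_UNIV])
  show tr: "subspace (tr D p)" unfolding tr_def by (rule subspace_sum_of[OF L(1) P])
  have perp_Rad: "metric D p s \<xi> = 0" if "s \<in> perp_sp D p" "\<xi> \<in> Rad D p" for s \<xi>
    using that unfolding Rad_def perp_sp_def by blast
  have ltr_perp: "n = 0" if "n \<in> ltr D p" "n \<in> perp_sp D p" for n
    using ltr_pairing_eq_0[OF lt p bil that(1)] perp_Rad[OF that(2)] by blast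
  have disj: "tan_sp D p \<inter> tr D p = {0}"
  proof -
    have "v = 0" if v: "v \<in> tan_sp D p" "v \<in> tr D p" for v
    proof -
      obtain n s where ns: "n \<in> ltr D p" "s \<in> scrperp D p" "v = n + s"
        using v(2) by (auto simp: tr_def sum_of_def)
      have s: "s \<in> perp_sp D p" using perp.parts_subset ns by blast
      \<comment> \<open>Both the tangent vector \<open>v\<close> and the normal vector
        \<open>s\<close> are orthogonal to the radical, hence so is \<open>n = v - s\<close>. Once
        \<open>n\<close> vanishes, \<open>v = s\<close> is radical and in
        \<open>scrperp\<close>.\<close>
      have "metric D p n \<xi> = 0" if \<xi>: "\<xi> \<in> Rad D p" for \<xi>
      proof -
        have "metric D p v \<xi> = 0" using \<xi> v(1) sym[of v \<xi>] by (auto simp: Rad_def perp_sp_def)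
        then show ?thesis using ns(3) perp_Rad[OF s \<xi>] bilinear_ladd[OF bil] by simp
      qed
      then have "n = 0" using ltr_pairing_eq_0[OF lt p bil ns(1)] by blast
      then have "v \<in> Rad D p \<inter> scrperp D p" using ns v(1) s by (simp add: Rad_def)
      then show ?thesis using perp.disjoint by blast
    qed
    then show ?thesis using subspace_0[OF T] subspace_0[OF tr] by blast
  qed
  have dim_sum: "dim (sum_of A B) = dim A + dim B"
    if "subspace A" "subspace B" "A \<inter> B = {0}" for A B :: "'e set"
    using dim_sums_Int[OF that(1,2)] that(3) by (simp add: sum_of_def)
  have "ltr D p \<inter> scrperp D p = {0}"
    using ltr_perp perp.parts_subset subspace_0[OF L(1)] subspace_0[OF P] by blast
  then have "dim (tr D p) = r + dim (scrperp D p)"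
    unfolding tr_def using dim_sum L P by simp
  also have "\<dots> = dim (perp_sp D p)"
    using dim_sum[OF R(1) P perp.disjoint] dsP R(2) by (simp add: direct_sum_def)
  finally have "dim (tan_sp D p) + dim (tr D p) = DIM('e)"
    using dim_bilinear_complement[OF bil nondeg T] by (simp add: perp_sp_def)
  then have "dim (sum_of (tan_sp D p) (tr D p)) = DIM('e)"
    using dim_sum[OF T tr disj] by simp
  then have "sum_of (tan_sp D p) (tr D p) = UNIV"
    using dim_eq_full[of "sum_of (tan_sp D p) (tr D p)"] subspace_sum_of[OF T tr] by (metis span_eq_iff)
  then show "direct_sum UNIV (tan_sp D p) (tr D p)" using disj by (simp add: direct_sum_def)
qed

text \<open>Since \<open>J\<^sup>2 = 3J + 1\<close>, the map \<open>J - 3\<close> is the inverse of \<open>J\<close>, and it preserves each of the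
  summands \<open>Bo\<close> and \<open>R\<close> of the tangent space.\<close>

lemma bronze_splitting:
  fixes J :: "'e::euclidean_space \<Rightarrow> 'e"
  assumes J: "linear J" "\<And>v. J (J v) = 3 *\<^sub>R J v + v"
    and T: "splitting UNIV T Tr" and RS: "splitting T R S" and S: "splitting S (J ` S \<inter> S) B"
    and JR: "J ` R = R" and fB: "\<And>v. v \<in> B \<Longrightarrow> comp_in T Tr (J v) \<in> B"
    and V: "V \<in> T" and W: "W = comp_in T Tr (J V) - 3 *\<^sub>R V + b" "b \<in> B" and E: "E - W \<in> R"
  shows "comp_in (J ` S \<inter> S) (sum_of B R) E = 0 \<and> comp_in R S W = 0 \<longleftrightarrow> V \<in> B"
proof -
  interpret T: splitting UNIV T Tr by (rule T)
  interpret RS: splitting T R S by (rule RS)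
  interpret S: splitting S "J ` S \<inter> S" B by (rule S)
  obtain vr vs where v1: "vr \<in> R" "vs \<in> S" "V = vr + vs" using V by (rule RS.sumE)
  obtain vo vb where v2: "vo \<in> J ` S \<inter> S" "vb \<in> B" "vs = vo + vb" using v1(2) by (rule S.sumE)
  obtain s where s: "s \<in> S" "vo = J s" using v2(1) by auto
  have s_eq: "s = J vo - 3 *\<^sub>R vo" using J(2)[of s] s(2) by simp
  \<comment> \<open>The inverse of \<open>J\<close> applied to \<open>s\<close> is
    \<open>J s - 3 s = vo - 3 s\<close>, a vector of \<open>S\<close>. Thus \<open>s\<close>, the
    inverse image of \<open>vo\<close>, lies again in the invariant part of the screen.\<close>
  have Js: "s = J (vo - 3 *\<^sub>R s)"
    using s_eq s(2) by (simp add: linear_diff[OF J(1)] linear_scale[OF J(1)])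
  have "vo - 3 *\<^sub>R s \<in> S" using v2(1) s(1) RS.B subspace_diff subspace_scale by blast
  then have sBo: "s \<in> J ` S \<inter> S" using Js s(1) by blast
  have JvoT: "J vo \<in> T"
  proof -
    have "J vo = s + 3 *\<^sub>R vo" using s_eq by simp
    then show ?thesis
      using s(1) v2(1) RS.parts_subset(2) RS.subspace subspace_add subspace_scale by (metis IntD2 subsetD)
  qed
  have JvrR: "J vr \<in> R" using JR v1(1) by blast
  define wr where "wr = J vr - 3 *\<^sub>R vr"
  have wr: "wr \<in> R" unfolding wr_def using JvrR v1(1) RS.A subspace_diff subspace_scale by blast
  define wb where "wb = comp_in T Tr (J vb) - 3 *\<^sub>R vb + b"
  have wb: "wb \<in> B" unfolding wb_def
    using fB[OF v2(2)] v2(2) W(2) S.B subspace_diff subspace_scale subspace_add by metis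
  \<comment> \<open>\<open>J vo\<close> and \<open>J vr\<close> are tangent, so projection acts only
    on \<open>J vb\<close>. The three terms are the components of \<open>W\<close> in the invariant
    part, in \<open>B\<close> and in \<open>R\<close>.\<close>
  have W_eq: "W = s + wb + wr"
  proof -
    have "comp_in T Tr (J V) = J vr + J vo + comp_in T Tr (J vb)"
      using T.comp_eq_self[OF JvoT] T.comp_eq_self[of "J vr"] JvrR RS.parts_subset(1)
      by (simp add: v1(3) v2(3) linear_add[OF J(1)] T.comp_add subsetD add.assoc)
    then show ?thesis
      unfolding W(1) wb_def wr_def s_eq v1(3) v2(3) by (simp add: algebra_simps)
  qed
  have 1: "comp_in R S W = wr"
    using RS.comp_eq[OF wr, of "s + wb"] sBo wb S.sumI[of s wb] unfolding W_eq by (simp add: ac_simps)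
  have "comp_in (J ` S \<inter> S) (sum_of B R) E = s"
  proof (rule comp_in_unique[OF S.A subspace_sum_of[OF S.B RS.A] _ sBo])
    \<comment> \<open>Passing from \<open>W\<close> to \<open>E\<close> alters only the radical
      part, which the projection to the invariant part ignores.\<close>
    have "E - s = wb + (wr + (E - W))" by (simp add: W_eq)
    moreover have "wr + (E - W) \<in> R" using wr E RS.A subspace_add by blast
    ultimately show "E - s \<in> sum_of B R" using wb unfolding sum_of_def by blast
    show "(J ` S \<inter> S) \<inter> sum_of B R = {0}"
    proof -
      have "x = 0" if x: "x \<in> J ` S \<inter> S" "x \<in> sum_of B R" for x
      proof -
        obtain y z where yz: "y \<in> B" "z \<in> R" "x = y + z" using x(2) unfolding sum_of_def by blast
        have "z = x - y" using yz(3) by simp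
        then have "z \<in> S" using x(1) yz(1) S.parts_subset RS.B subspace_diff by (metis IntD2 subsetD)
        then have "z = 0" using yz(2) RS.disjoint by blast
        then show ?thesis using x(1) yz S.disjoint by auto
      qed
      then show ?thesis
        using subspace_0[OF S.A] subspace_0[OF subspace_sum_of[OF S.B RS.A]] by blast
    qed
  qed
  moreover have "s = 0 \<and> wr = 0 \<longleftrightarrow> V \<in> B"
  proof
    assume 0: "s = 0 \<and> wr = 0"
    have "vo = 0" using 0 s(2) linear_0[OF J(1)] by simp
    moreover have "vr = 0"
    proof -
      have "J wr = vr" unfolding wr_def using J(2)[of vr]
        by (simp add: linear_diff[OF J(1)] linear_scale[OF J(1)])
      then show ?thesis using 0 linear_0[OF J(1)] by simp
    qed
    ultimately show "V \<in> B" using v1(3) v2 by simp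
  next
    assume VB: "V \<in> B"
    then have VS: "V \<in> S" using S.parts_subset by blast
    have "vr = V - vs" using v1(3) by simp
    then have "vr \<in> S" using VS v1(2) RS.B subspace_diff by blast
    then have vr: "vr = 0" using v1(1) RS.disjoint by blast
    have "vo = V - vb" using v1(3) v2(3) vr by simp
    then have "vo \<in> B" using VB v2(2) S.B subspace_diff by blast
    then have "vo = 0" using v2(1) S.disjoint by blast
    then show "s = 0 \<and> wr = 0" using vr s_eq linear_0[OF J(1)] by (simp add: wr_def)
  qed
  ultimately show ?thesis using 1 by simp
qed

section \<open>Screen generic submanifolds and the equivalence at a point\<close>

lemma screen_genericD:
  assumes "screen_generic D r B'"
  shows "lightlike_submanifold D r"
    and "\<exists>k. distribution (amb D) (submfd D) k (B_o D)"
    and "\<exists>k. distribution (amb D) (submfd D) k B'"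
    and "\<And>p. p \<in> carrier (submfd D) \<Longrightarrow> brz D p ` Rad D p = Rad D p"
    and "\<And>p. p \<in> carrier (submfd D) \<Longrightarrow> direct_sum (scr D p) (B_o D p) (B' p)"
    and "\<And>U Y. openin (topo (submfd D)) U \<Longrightarrow> Y \<in> \<Gamma>_on D U B' \<Longrightarrow> fpart D Y \<in> \<Gamma>_on D U B'"
    and "\<And>U Y. openin (topo (submfd D)) U \<Longrightarrow> Y \<in> \<Gamma>_on D U B' \<Longrightarrow> wpart D Y \<in> \<Gamma>_on D U (scrperp D)"
  using assms unfolding screen_generic_def by (elim conjE; simp)+

text \<open>Screen genericity speaks of smooth sections. Every vector of a fibre is a combination of
  a local frame, and the clause covers sections over arbitrary open sets, so linearity of the
  tangential part of \<open>J\<close> gives the fibrewise statement.\<close>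

lemma fpart_mem:
  assumes sg: "screen_generic D r B'" and p: "p \<in> carrier (submfd D)"
    and J: "linear (brz D p)" and T: "splitting UNIV (tan_sp D p) (tr D p)" and v: "v \<in> B' p"
  shows "comp_in (tan_sp D p) (tr D p) (brz D p v) \<in> B' p"
proof -
  interpret T: splitting UNIV "tan_sp D p" "tr D p" by (rule T)
  note f = screen_genericD(6)[OF sg]
  obtain k where dist: "distribution (amb D) (submfd D) k B'"
    using screen_genericD(3)[OF sg] by blast
  obtain U s where U: "openin (topo (submfd D)) U" "p \<in> U" "\<forall>i<k. s i \<in> \<Gamma>_on D U B'"
    and span: "B' p = span ((\<lambda>i. s i p) ` {..<k})"
    using dist p unfolding distribution_def by metis
  have B: "subspace (B' p)" by (rule distribution_subspace(1)[OF dist p])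
  have "v \<in> span ((\<lambda>i. s i p) ` {..<k})" using v span by simp
  then show ?thesis
  proof (rule span_induct)
    show "subspace {v. comp_in (tan_sp D p) (tr D p) (brz D p v) \<in> B' p}"
      unfolding subspace_def
      using subspace_0[OF B] subspace_add[OF B] subspace_scale[OF B] T.comp_eq_self[OF subspace_0[OF T.A]]
      by (auto simp: linear_0[OF J] linear_add[OF J] linear_scale[OF J] T.comp_add T.comp_scale)
    fix v assume "v \<in> (\<lambda>i. s i p) ` {..<k}"
    then obtain i where i: "i < k" "v = s i p" by auto
    then have "fpart D (s i) \<in> \<Gamma>_on D U B'" using f U by blast
    then have "fpart D (s i) p \<in> B' p" using U(2) unfolding sections_def by blast
    then show "comp_in (tan_sp D p) (tr D p) (brz D p v) \<in> B' p" using i by (simp add: fpart_def)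
  qed
qed

theorem theorem5p8:
  fixes D :: "('a, 'e::euclidean_space, 'f::euclidean_space) lightlike_data"
    and q r :: nat
    and B' :: "'a \<Rightarrow> 'e set"
  assumes "locally_bronze (amb D) (metric D) q (brz D)"
    and "screen_generic D r B'"
    and "lm_type D"
  shows "integrable_distribution (amb D) (submfd D) B' \<longleftrightarrow>
    (\<forall>Y\<in>\<Gamma> D B'. \<forall>Z\<in>\<Gamma> D B'. \<forall>p\<in>carrier (submfd D).
       B_o_comp D B' p
         (\<Omega>_star D Y (fpart D Z) p + A_bar D (wpart D Y) Z p + 3 *\<^sub>R \<Omega>_star D Z Y p
          - \<Omega>_star D Z (fpart D Y) p - A_bar D (wpart D Z) Y p - 3 *\<^sub>R \<Omega>_star D Y Z p) = 0 \<and>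
       Rad_comp D p (A_bar D (wpart D Y) Z p) + h_star D Y (fpart D Z) p + 3 *\<^sub>R h_star D Z Y p
         = Rad_comp D p (A_bar D (wpart D Z) Y p) + h_star D Z (fpart D Y) p + 3 *\<^sub>R h_star D Y Z p)"
proof -
  have ll: "lightlike_submanifold D r" and sub: "submanifold (amb D) (submfd D)"
    using screen_genericD(1)[OF assms(2)] by (simp_all add: lightlike_submanifold_def)
  have bronze: "bronze_manifold (amb D) (metric D) q (brz D)"
    using assms(1) unfolding locally_bronze_def by blast
  interpret semi_riemannian_inclusion "amb D" "submfd D" "metric D" q
    using submanifold_smooth_inclusion[OF sub] bronze
    by (simp add: semi_riemannian_inclusion_def semi_riemannian_metric_def bronze_manifold_def)
  have J: "linear (brz D p)" "brz D p (brz D p v) = 3 *\<^sub>R brz D p v + v" if "p \<in> carrier (amb D)" for p v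
    using bronze that unfolding bronze_manifold_def by blast+
  have J_smooth: "smooth_on (snd C ` fst C) (endo_rep (amb D) C (brz D) u)" if "C \<in> atlas (amb D)" for C u
    using bronze that unfolding bronze_manifold_def by blast
  have J_par: "nabla_endo (amb D) (metric D) (brz D) p v u = 0" if "p \<in> carrier (amb D)" for p u v
    using assms(1) that unfolding locally_bronze_def by blast
  have split_T: "splitting UNIV (tan_sp D p) (tr D p)" if p: "p \<in> carrier (submfd D)" for p
    by (rule tangent_transversal_splitting[OF ll p metric[OF carrierD[OF p]]])
  have split_RS: "splitting (tan_sp D p) (Rad D p) (scr D p)" if p: "p \<in> carrier (submfd D)" for p
    using lightlike_submanifoldD(3,4,6)[OF ll] p distribution_subspace(1)[OF _ p] unfolding splitting_def by blast
  have split_S: "splitting (scr D p) (B_o D p) (B' p)" if p: "p \<in> carrier (submfd D)" for p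
    using screen_genericD(2,3,5)[OF assms(2)] p distribution_subspace(1)[OF _ p] unfolding splitting_def by blast
  have B'_tan: "v \<in> tan_sp D p" if "p \<in> carrier (submfd D)" "v \<in> B' p" for p v
    using splitting.parts_subset(2)[OF split_S] splitting.parts_subset(2)[OF split_RS] that by blast
  \<comment> \<open>Integrability and the two conditions quantify over the same sections and points,
    so the equivalence can be proved for each \<open>Y\<close>, \<open>Z\<close>, \<open>p\<close>
    separately.\<close>
  have pointwise: "dincl (amb D) (submfd D) p (lie_bracket (submfd D) (pull (amb D) (submfd D) Y) (pull (amb D) (submfd D) Z) p) \<in> B' p \<longleftrightarrow>
       B_o_comp D B' p
         (\<Omega>_star D Y (fpart D Z) p + A_bar D (wpart D Y) Z p + 3 *\<^sub>R \<Omega>_star D Z Y p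
          - \<Omega>_star D Z (fpart D Y) p - A_bar D (wpart D Z) Y p - 3 *\<^sub>R \<Omega>_star D Y Z p) = 0 \<and>
       Rad_comp D p (A_bar D (wpart D Y) Z p) + h_star D Y (fpart D Z) p + 3 *\<^sub>R h_star D Z Y p
         = Rad_comp D p (A_bar D (wpart D Z) Y p) + h_star D Z (fpart D Y) p + 3 *\<^sub>R h_star D Y Z p"
    (is "?V \<in> B' p \<longleftrightarrow> B_o_comp D B' p ?E = 0 \<and> ?ii")
    if Y: "Y \<in> \<Gamma> D B'" and Z: "Z \<in> \<Gamma> D B'" and p: "p \<in> carrier (submfd D)" for Y Z p
  proof -
    note pM = carrierD[OF p]
    interpret T: splitting UNIV "tan_sp D p" "tr D p" by (rule split_T[OF p])
    interpret RS: splitting "tan_sp D p" "Rad D p" "scr D p" by (rule split_RS[OF p])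
    interpret S: splitting "scr D p" "B_o D p" "B' p" by (rule split_S[OF p])
    define PT where "PT = comp_in (tan_sp D p) (tr D p)"
    have PT: "linear PT" unfolding PT_def by (rule linearI) (simp_all add: T.comp_add T.comp_scale)
    have PT_tan: "PT v \<in> tan_sp D p" for v unfolding PT_def by (simp add: T.comp_mem)
    define PR where "PR = comp_in (Rad D p) (scr D p)"
    note T_closed = subspace_add[OF T.A] subspace_diff[OF T.A] subspace_scale[OF T.A]
    define L where "L X A = levi_civita (amb D) (submfd D) (metric D) X A p" for X A
    define k where "k v = lfun D p *\<^sub>R v + mfun D p *\<^sub>R brz D p v" for v
    define \<theta> where "\<theta> v = metric D p v (eta D p)" for v
    have \<theta>_add: "\<theta> (u + v) = \<theta> u + \<theta> v" for u v
      unfolding \<theta>_def by (rule bilinear_ladd[OF metric(1)[OF pM]])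
    have tanX: "X q \<in> tan_sp D q" if "X \<in> \<Gamma> D B'" "q \<in> carrier (submfd D)" for X q
      using that B'_tan unfolding sections_def by blast
    have mem: "X p \<in> B' p" if "X \<in> \<Gamma> D B'" for X using that p unfolding sections_def by blast
    have fw: "fpart D X q + wpart D X q = brz D q (X q)" if "q \<in> carrier (submfd D)" for X q
      unfolding fpart_def wpart_def using splitting.comp_sum_eq[OF split_T[OF that]] by blast
    have fw_sec: "fpart D X \<in> \<Gamma> D B'" "wpart D X \<in> \<Gamma> D (scrperp D)" if "X \<in> \<Gamma> D B'" for X
      using screen_genericD(6,7)[OF assms(2) openin_topspace that] by blast+
    have LJ: "L X (fpart D A) + L X (wpart D A) = brz D p (L X A)"
      if X: "X \<in> \<Gamma> D B'" and A: "A \<in> \<Gamma> D B'" for X A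
    proof -
      have "levi_civita (amb D) (submfd D) (metric D) X (\<lambda>q. brz D q (A q)) p = L X (fpart D A) + L X (wpart D A)"
        unfolding L_def by (rule levi_civita_add[OF p fw_sec[OF A]]) (simp add: fw)
      moreover have "levi_civita (amb D) (submfd D) (metric D) X (\<lambda>q. brz D q (A q)) p = brz D p (L X A)"
        unfolding L_def by (rule levi_civita_parallel[where J = "brz D" and X = X and Z = A, OF J(1) J_smooth J_par[OF pM] p tanX[OF X p] A])
      ultimately show ?thesis by simp
    qed
    have \<Omega>: "\<Omega>_bar D X A p = L X A + \<theta> (A p) *\<^sub>R k (X p)" for X A
      by (simp add: \<Omega>_bar_def L_def \<theta>_def k_def)
    have \<Omega>i: "\<Omega>_ind D X A p = PT (L X A + \<theta> (A p) *\<^sub>R k (X p))" for X A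
      by (simp add: \<Omega>_ind_def PT_def \<Omega>)
    have Ab: "A_bar D A X p = - PT (L X A + \<theta> (A p) *\<^sub>R k (X p))" for X A
      by (simp add: A_bar_def PT_def \<Omega>)
    have V: "?V = L Y Z - L Z Y"
      unfolding L_def
      by (rule levi_civita_torsion_free[OF _ p Y tanX[OF Y] Z tanX[OF Z]])
        (use sub p in \<open>auto simp: submanifold_def\<close>)
    have V_tan: "?V \<in> tan_sp D p" by (simp add: tangent_def)
    define a1 a2 o1 o2 o3 o4 where "a1 = A_bar D (wpart D Y) Z p" and "a2 = A_bar D (wpart D Z) Y p"
      and "o1 = \<Omega>_ind D Y (fpart D Z) p" and "o2 = \<Omega>_ind D Z Y p"
      and "o3 = \<Omega>_ind D Z (fpart D Y) p" and "o4 = \<Omega>_ind D Y Z p"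
    note defs = a1_def a2_def o1_def o2_def o3_def o4_def
    \<comment> \<open>The vector of (i) with every \<open>\<Omega>_star\<close> replaced by the full
      \<open>\<Omega>_ind\<close>. Its radical part is the difference of the two sides of
      (ii).\<close>
    define W where "W = o1 + a1 + 3 *\<^sub>R o2 - o3 - a2 - 3 *\<^sub>R o4"
    have tan: "a1 \<in> tan_sp D p" "a2 \<in> tan_sp D p" "o1 \<in> tan_sp D p" "o2 \<in> tan_sp D p"
      "o3 \<in> tan_sp D p" "o4 \<in> tan_sp D p"
      unfolding defs \<Omega>i Ab using PT_tan subspace_neg[OF T.A] by auto
    have ii: "?ii \<longleftrightarrow> PR W = 0"
    proof -
      have "PR W = PR o1 + PR a1 + 3 *\<^sub>R PR o2 - PR o3 - PR a2 - 3 *\<^sub>R PR o4"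
        unfolding W_def PR_def
        by (simp add: RS.comp_add RS.comp_diff RS.comp_scale tan T_closed)
      then have "PR W = (PR a1 + PR o1 + 3 *\<^sub>R PR o2) - (PR a2 + PR o3 + 3 *\<^sub>R PR o4)"
        by (simp add: algebra_simps)
      moreover have "?ii \<longleftrightarrow> PR a1 + PR o1 + 3 *\<^sub>R PR o2 = PR a2 + PR o3 + 3 *\<^sub>R PR o4"
        by (simp add: Rad_comp_def h_star_def PR_def defs)
      ultimately show ?thesis by simp
    qed
    \<comment> \<open>\<open>A_bar\<close> enters (i) unprojected, so the two vectors differ only by
      the radical parts of the \<open>\<Omega>_ind\<close> terms.\<close>
    have E: "?E - W \<in> Rad D p"
    proof -
      define d where "d v = comp_in (scr D p) (Rad D p) v - v" for v
      have d: "d v \<in> Rad D p" if "v \<in> tan_sp D p" for v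
      proof -
        have "d v = - comp_in (Rad D p) (scr D p) v"
          using RS.comp_sum_eq[OF that] by (simp add: d_def algebra_simps)
        then show ?thesis using RS.comp_mem(1)[OF that] subspace_neg[OF RS.A] by simp
      qed
      have "?E - W = d o1 + 3 *\<^sub>R d o2 - d o3 - 3 *\<^sub>R d o4"
        by (simp add: W_def d_def defs \<Omega>_star_def algebra_simps)
      then show ?thesis
        using d tan subspace_add[OF RS.A] subspace_diff[OF RS.A] subspace_scale[OF RS.A] by simp
    qed
    have fB: "PT (brz D p v) \<in> B' p" if "v \<in> B' p" for v
      unfolding PT_def by (rule fpart_mem[OF assms(2) p J(1)[OF pM] split_T[OF p] that])
    have kB: "PT (k v) \<in> B' p" if v: "v \<in> B' p" for v
    proof -
      have "PT v = v" unfolding PT_def by (rule T.comp_eq_self[OF B'_tan[OF p v]])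
      then show ?thesis
        unfolding k_def using v fB[OF v] subspace_add[OF S.B] subspace_scale[OF S.B]
        by (simp add: linear_add[OF PT] linear_scale[OF PT])
    qed
    \<comment> \<open>Collects what the connection adds to \<open>W\<close>. In the direction
      \<open>Y\<close> the weights are \<open>\<theta>(fZ)\<close> from \<open>o1\<close>,
      \<open>\<theta>(wZ)\<close> from \<open>- a2\<close> and \<open>- 3 \<theta>(Z)\<close> from
      \<open>- 3 o4\<close>; the first two add up to \<open>\<theta>(JZ)\<close>.\<close>
    define b where "b = (\<theta> (brz D p (Z p)) - 3 * \<theta> (Z p)) *\<^sub>R PT (k (Y p)) -
      (\<theta> (brz D p (Y p)) - 3 * \<theta> (Y p)) *\<^sub>R PT (k (Z p))"
    have bB: "b \<in> B' p"
      unfolding b_def using kB[OF mem[OF Y]] kB[OF mem[OF Z]] subspace_diff[OF S.B] subspace_scale[OF S.B] by blast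
    have "W = PT (brz D p ?V) - 3 *\<^sub>R ?V + b"
    proof -
      have 1: "PT (brz D p ?V) = PT (L Y (fpart D Z)) + PT (L Y (wpart D Z)) - PT (L Z (fpart D Y)) - PT (L Z (wpart D Y))"
        unfolding V linear_diff[OF J(1)[OF pM]] LJ[OF Y Z, symmetric] LJ[OF Z Y, symmetric]
        by (simp add: linear_diff[OF PT] linear_add[OF PT])
      \<comment> \<open>Neither covariant derivative need be tangent, but their difference is, so
        projecting it changes nothing.\<close>
      have 2: "?V = PT (L Y Z) - PT (L Z Y)"
        using T.comp_eq_self[OF V_tan] V unfolding PT_def[symmetric] by (metis linear_diff[OF PT])
      have 3: "\<theta> (brz D p (A p)) = \<theta> (fpart D A p) + \<theta> (wpart D A p)" for A
        unfolding fw[OF p, symmetric] by (rule \<theta>_add)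
      show ?thesis
        unfolding 1 unfolding 2 unfolding W_def b_def defs \<Omega>i Ab 3
        by (simp add: linear_add[OF PT] linear_scale[OF PT] algebra_simps)
    qed
    note core = bronze_splitting[OF J(1)[OF pM] J(2)[OF pM] split_T[OF p] split_RS[OF p]
        split_S[OF p, unfolded B_o_def] _ fB[unfolded PT_def] V_tan this[unfolded PT_def] bB E]
    from core[OF screen_genericD(4)[OF assms(2) p]] show ?thesis
      unfolding ii PR_def B_o_comp_def B_o_def by blast
  qed
  then show ?thesis unfolding integrable_distribution_def by blast
qed

end
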